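(* Suppose $\gamma_n=0$ for all $n$ (i.e. $\alpha_n+\beta_n=1$), $E\varepsilon_0^2=1$, $E|\varepsilon_0|^{4+\delta}<\infty$ for some $\delta>0$, and, as $n\to\infty$, $n^{1/2}\alpha_n\to0$ and $n\alpha_n\to\infty$. Let $N\ge1$ be a fixed integer and $0<t_1<t_2<\cdots<t_N\le1$. Then, as $n\to\infty$, $$\frac{1}{n^{3/2}\alpha}\frac{1}{\sqrt{E\xi_0^2}}\Big[\frac{\sigma_{[nt_m]}^2}{\omega}-[nt_m],\ m=1,2,\dots,N\Big]\xrightarrow{d}[\zeta_m,\ m=1,2,\dots,N],$$ where $[\zeta_m,\ m=1,\dots,N]$ is an $N$-variate Gaussian vector with mean zero and covariances $$E[\zeta_i\zeta_j]=\tfrac13[\min(t_i,t_j)]^3.$$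
   Context: Let $\varepsilon_0,\varepsilon_1,\varepsilon_2,\dots$ be independent identically distributed real random variables (not necessarily of mean zero) such that the distribution of $\varepsilon_0^2$ is nondegenerate. Let $\omega>0$ be a constant. For each $n\ge1$ let $\alpha=\alpha_n\ge0$ and $\beta=\beta_n\ge0$ be real numbers with $\alpha_n\to0$ and $\beta_n\to1$ as $n\to\infty$. Given an initial value $\sigma_0$ (a fixed real number not depending on $n$) and $y_0=\sigma_0\varepsilon_0$, define for each $n$ the sequences $\sigma_k\ge 0$ and $y_k$, $1\le k\le n$ (which depend on $n$ through $\alpha_n,\beta_n$), by $y_k=\sigma_k\varepsilon_k$ and $\sigma_k^2=\omega+\alpha y_{k-1}^2+\beta\sigma_{k-1}^2$. Put $\gamma=\gamma_n=\alpha_n+\beta_n-1$ and $\xi_j=\varepsilon_j^2-1$. $[x]$ (for a single real number $x$) denotes the integer part of $x$. *)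

theory Defs
  imports "HOL-Probability.Probability"
begin

text \<open>
  The arguments are the constants \<open>\<omega>\<close>, \<open>\<alpha>\<close>, \<open>\<beta>\<close>, the initial value \<open>s0\<close> and one realisation \<open>e\<close> of
  the innovations. For nonnegative \<open>\<omega>\<close>, \<open>\<alpha>\<close>, \<open>\<beta>\<close> the square root is the unique nonnegative solution
  of the recursion for the squared volatility. The initial value itself may be negative.
\<close>

primrec garch_sigma :: "real \<Rightarrow> real \<Rightarrow> real \<Rightarrow> real \<Rightarrow> (nat \<Rightarrow> real) \<Rightarrow> nat \<Rightarrow> real" where
  "garch_sigma \<omega> \<alpha> \<beta> s0 e 0 = s0"
| "garch_sigma \<omega> \<alpha> \<beta> s0 e (Suc k) =
     (let \<sigma> = garch_sigma \<omega> \<alpha> \<beta> s0 e k; y = \<sigma> * e k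
      in sqrt (\<omega> + \<alpha> * y\<^sup>2 + \<beta> * \<sigma>\<^sup>2))"

text \<open>
  The library's \<open>weak_conv_m\<close> is formulated through distribution functions and covers measures on the
  real line only.
\<close>

definition weakly_converges ::
    "(nat \<Rightarrow> 'a::topological_space measure) \<Rightarrow> 'a measure \<Rightarrow> bool" where
  "weakly_converges \<mu> \<nu> \<longleftrightarrow>
     (\<forall>f :: 'a \<Rightarrow> real. continuous_on UNIV f \<longrightarrow> bounded (range f) \<longrightarrow>
        (\<lambda>n. \<integral>x. f x \<partial>\<mu> n) \<longlonglongrightarrow> (\<integral>x. f x \<partial>\<nu>))"

text \<open>
  Gaussian distributions are allowed to be degenerate: standard deviation zero means a point mass.
\<close>

definition gaussian_law :: "real measure \<Rightarrow> bool" where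
  "gaussian_law \<mu> \<longleftrightarrow>
     (\<exists>m. \<mu> = return borel m) \<or> (\<exists>m s. 0 < s \<and> \<mu> = density lborel (normal_density m s))"

definition multivariate_gaussian :: "(real ^ 'n) measure \<Rightarrow> bool" where
  "multivariate_gaussian \<mu> \<longleftrightarrow>
     prob_space \<mu> \<and> sets \<mu> = sets borel \<and> (\<forall>a. gaussian_law (distr \<mu> borel (\<lambda>x. a \<bullet> x)))"

end

theory Submission
  imports Defs
begin

text \<open>
  With \<open>D\<^sub>k = \<sigma>\<^sub>k\<^sup>2 / \<omega> - k\<close> the recursion becomes \<open>D\<^sub>k\<^sub>+\<^sub>1 = D\<^sub>k + \<alpha> (k + D\<^sub>k) \<xi>\<^sub>k\<close>, so that
  \<open>D\<^sub>k = \<sigma>\<^sub>0\<^sup>2 / \<omega> + \<alpha> \<Sum>\<^sub>i i \<xi>\<^sub>i + \<alpha> \<Sum>\<^sub>i D\<^sub>i \<xi>\<^sub>i\<close>, both sums over \<open>i < k\<close>. Since the increments of \<open>D\<close> are orthogonal in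
  \<open>L\<^sup>2\<close>, \<open>E D\<^sub>k\<^sup>2\<close> satisfies a linear recursion, whose solution shows that the last sum and the constant are
  negligible after normalisation. The sums \<open>\<Sum>\<^sub>i i \<xi>\<^sub>i\<close> up to \<open>[n t\<^sub>m]\<close> are partial sums of independent block
  sums. Each block sum obeys a central limit theorem, and independence makes the vector of block sums converge
  jointly, so no multivariate continuity theorem for characteristic functions is needed.
\<close>

section \<open>Weak convergence of product measures\<close>

text \<open>The linear sum dictates the normalisation: with k = [nt], the sum of
  \<open>i\<^sup>2\<close> over i < k is asymptotically n^3 t^3 / 3, which is also the limiting
  variance. The values at two times share exactly the blocks up to the earlier time, hence the
  minimum in the covariance. The obstacle is the other sum, whose terms
  \<open>D\<^sub>i \<xi>\<^sub>i\<close> are dependent. Each \<open>\<xi>\<^sub>i\<close> is still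
  centred and independent of \<open>D\<^sub>i\<close>, so second moments suffice: while n \<alpha>^2
  stays bounded, E \<open>D\<^sub>k\<^sup>2\<close> is O(1 + \<alpha>^2 n^3) for k up to n, and
  after division by n^(3/2) the sum has second moment O(1/n^2 + n \<alpha>^2). This vanishes because
  n^(1/2) \<alpha> tends to 0. The constant, divided by n^(3/2) \<alpha>, vanishes because n
  \<alpha> tends to infinity.\<close>

lemma indep_vars_PiM_coordinates:
  assumes "I \<noteq> {}" "\<And>i. i \<in> I \<Longrightarrow> prob_space (M i)"
  shows "prob_space.indep_vars (PiM I M) M (\<lambda>i \<omega>. \<omega> i) I"
proof -
  interpret prob_space "PiM I M" by (rule prob_space_PiM) (use assms in auto)
  \<comment> \<open>Points of the product space are extensional on \<open>I\<close>, so restricting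
    them to \<open>I\<close> is the identity.\<close>
  have "distr (PiM I M) (PiM I M) (\<lambda>x. \<lambda>i\<in>I. x i) = distr (PiM I M) (PiM I M) (\<lambda>x. x)"
    by (intro distr_cong) (auto simp: space_PiM)
  also have "\<dots> = PiM I M" by simp
  also have "\<dots> = PiM I (\<lambda>i. distr (PiM I M) (M i) (\<lambda>\<omega>. \<omega> i))"
    by (intro PiM_cong) (auto simp: distr_PiM_component assms)
  finally show ?thesis
    by (subst indep_vars_iff_distr_eq_PiM'[OF assms(1)]) auto
qed

text \<open>Needed to recognise the image of a product of representing spaces, under maps acting
  coordinatewise, as the product of the represented laws.\<close>

lemma distr_PiM_map:
  assumes "I \<noteq> {}" "\<And>i. i \<in> I \<Longrightarrow> prob_space (M i)"
    and [measurable]: "\<And>i. i \<in> I \<Longrightarrow> Y i \<in> measurable (M i) (N i)"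
  shows "distr (PiM I M) (PiM I N) (\<lambda>\<omega>. \<lambda>i\<in>I. Y i (\<omega> i)) = PiM I (\<lambda>i. distr (M i) (N i) (Y i))"
proof -
  interpret prob_space "PiM I M" by (rule prob_space_PiM) (use assms in auto)
  have "indep_vars N (\<lambda>i \<omega>. Y i (\<omega> i)) I"
    by (rule indep_vars_compose2[OF indep_vars_PiM_coordinates]) (use assms in auto)
  then have "distr (PiM I M) (PiM I N) (\<lambda>\<omega>. \<lambda>i\<in>I. Y i (\<omega> i)) = PiM I (\<lambda>i. distr (PiM I M) (N i) (\<lambda>\<omega>. Y i (\<omega> i)))"
    by (subst (asm) indep_vars_iff_distr_eq_PiM'[OF assms(1)]) auto
  also have "\<dots> = PiM I (\<lambda>i. distr (M i) (N i) (Y i))"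
  proof (intro PiM_cong refl)
    fix i assume [simp]: "i \<in> I"
    have "distr (PiM I M) (N i) (\<lambda>\<omega>. Y i (\<omega> i)) = distr (distr (PiM I M) (M i) (\<lambda>\<omega>. \<omega> i)) (N i) (Y i)"
      by (subst distr_distr) (auto simp: comp_def)
    also have "\<dots> = distr (M i) (N i) (Y i)"
      using assms(2) by (simp add: distr_PiM_component)
    finally show "distr (PiM I M) (N i) (\<lambda>\<omega>. Y i (\<omega> i)) = distr (M i) (N i) (Y i)" .
  qed
  finally show ?thesis .
qed

text \<open>Skorohod's theorem in every coordinate turns weak convergence into pointwise convergence on a
  product of the representing spaces, so that dominated convergence applies.\<close>
lemma weak_conv_PiM:
  fixes \<mu> :: "nat \<Rightarrow> 'n::finite \<Rightarrow> real measure" and f :: "('n \<Rightarrow> real) \<Rightarrow> real"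
  assumes \<mu>: "\<And>n l. real_distribution (\<mu> n l)" and \<nu>: "\<And>l. real_distribution (\<nu> l)"
    and conv: "\<And>l. weak_conv_m (\<lambda>n. \<mu> n l) (\<nu> l)"
    and f[measurable]: "f \<in> borel_measurable (PiM UNIV (\<lambda>_. borel))"
    and bound: "\<And>z. \<bar>f z\<bar> \<le> B"
    and cont: "\<And>z z'. (\<And>l. (\<lambda>n. z n l) \<longlonglongrightarrow> z' l) \<Longrightarrow> (\<lambda>n. f (z n)) \<longlonglongrightarrow> f z'"
  shows "(\<lambda>n. \<integral>z. f z \<partial>PiM UNIV (\<mu> n)) \<longlonglongrightarrow> (\<integral>z. f z \<partial>PiM UNIV \<nu>)"
proof -
  have "\<forall>l. \<exists>(\<Omega> :: real measure) Ys Y. prob_space \<Omega> \<and> (\<forall>n. Ys n \<in> measurable \<Omega> borel) \<and>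
      (\<forall>n. distr \<Omega> borel (Ys n) = \<mu> n l) \<and> Y \<in> measurable \<Omega> lborel \<and> distr \<Omega> borel Y = \<nu> l \<and>
      (\<forall>x \<in> space \<Omega>. (\<lambda>n. Ys n x) \<longlonglongrightarrow> Y x)"
    using Skorohod[OF \<mu> \<nu> conv] by blast
  then obtain \<Omega> :: "'n \<Rightarrow> real measure" and Ys Y
    where \<Omega>: "\<And>l. prob_space (\<Omega> l)" and Ys[measurable]: "\<And>l n. Ys l n \<in> borel_measurable (\<Omega> l)"
      and dYs: "\<And>l n. distr (\<Omega> l) borel (Ys l n) = \<mu> n l"
      and Y: "\<And>l. Y l \<in> measurable (\<Omega> l) lborel" and dY: "\<And>l. distr (\<Omega> l) borel (Y l) = \<nu> l"
      and lim: "\<And>l x. x \<in> space (\<Omega> l) \<Longrightarrow> (\<lambda>n. Ys l n x) \<longlonglongrightarrow> Y l x"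
    by metis
  have [measurable]: "Y l \<in> borel_measurable (\<Omega> l)" for l using Y[of l] by simp
  interpret prob_space "PiM UNIV \<Omega>" by (rule prob_space_PiM) (use \<Omega> in auto)
  have meas: "(\<lambda>\<omega> l. X l (\<omega> l)) \<in> measurable (PiM UNIV \<Omega>) (PiM UNIV (\<lambda>_. borel))"
    if [measurable]: "\<And>l. X l \<in> borel_measurable (\<Omega> l)" for X :: "'n \<Rightarrow> real \<Rightarrow> real"
    by (rule measurable_PiM_single') (auto simp: space_PiM)
  have transfer: "(\<integral>z. f z \<partial>PiM UNIV (\<lambda>l. distr (\<Omega> l) borel (X l))) = (\<integral>\<omega>. f (\<lambda>l. X l (\<omega> l)) \<partial>PiM UNIV \<Omega>)"
    if [measurable]: "\<And>l. X l \<in> borel_measurable (\<Omega> l)" for X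
  proof -
    have "PiM UNIV (\<lambda>l. distr (\<Omega> l) borel (X l)) = distr (PiM UNIV \<Omega>) (PiM UNIV (\<lambda>_. borel)) (\<lambda>\<omega>. \<lambda>l\<in>UNIV. X l (\<omega> l))"
      by (rule distr_PiM_map[symmetric]) (use \<Omega> in auto)
    then show ?thesis using meas[of X] by (simp add: integral_distr restrict_UNIV)
  qed
  have "(\<lambda>n. \<integral>\<omega>. f (\<lambda>l. Ys l n (\<omega> l)) \<partial>PiM UNIV \<Omega>) \<longlonglongrightarrow> (\<integral>\<omega>. f (\<lambda>l. Y l (\<omega> l)) \<partial>PiM UNIV \<Omega>)"
  proof (rule integral_dominated_convergence[where w="\<lambda>_. B"])
    show "AE \<omega> in PiM UNIV \<Omega>. (\<lambda>n. f (\<lambda>l. Ys l n (\<omega> l))) \<longlonglongrightarrow> f (\<lambda>l. Y l (\<omega> l))"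
      by (intro AE_I2 cont lim) (auto simp: space_PiM)
    show "(\<lambda>\<omega>. f (\<lambda>l. Y l (\<omega> l))) \<in> borel_measurable (PiM UNIV \<Omega>)"
      by (rule measurable_compose[OF meas f]) simp
    show "(\<lambda>\<omega>. f (\<lambda>l. Ys l n (\<omega> l))) \<in> borel_measurable (PiM UNIV \<Omega>)" for n
      by (rule measurable_compose[OF meas f]) simp
  qed (use bound in auto)
  also have "(\<lambda>n. \<integral>\<omega>. f (\<lambda>l. Ys l n (\<omega> l)) \<partial>PiM UNIV \<Omega>) = (\<lambda>n. \<integral>z. f z \<partial>PiM UNIV (\<mu> n))"
    using transfer[of "\<lambda>l. Ys l n" for n] by (simp add: dYs)
  also have "(\<integral>\<omega>. f (\<lambda>l. Y l (\<omega> l)) \<partial>PiM UNIV \<Omega>) = (\<integral>z. f z \<partial>PiM UNIV \<nu>)"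
    using transfer[of Y] by (simp add: dY)
  finally show ?thesis .
qed

section \<open>Centred normal laws and weighted sums\<close>

text \<open>The parameter is the variance. Scaling a standard normal variable, instead of giving a
  density, includes the point mass at \<open>v = 0\<close> without a case distinction.\<close>

definition centered_normal :: "real \<Rightarrow> real measure" where
  "centered_normal v = distr std_normal_distribution borel (\<lambda>x. sqrt v * x)"

lemma real_distribution_centered_normal [simp]: "real_distribution (centered_normal v)"
proof -
  interpret real_distribution std_normal_distribution by (rule real_dist_normal_dist)
  show ?thesis unfolding centered_normal_def by (rule real_distribution_distr) simp
qed

lemma char_centered_normal:
  assumes "0 \<le> v"
  shows "char (centered_normal v) t = of_real (exp (- (v * t\<^sup>2 / 2)))"
proof -
  have "char (centered_normal v) t = char std_normal_distribution (sqrt v * t)"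
    unfolding char_def centered_normal_def by (subst integral_distr) (auto simp: mult_ac)
  also have "\<dots> = of_real (exp (- (v * t\<^sup>2 / 2)))"
    using assms by (simp add: char_std_normal_distribution power_mult_distrib)
  finally show ?thesis .
qed

text \<open>The case distinction avoided in \<open>centered_normal\<close> is made here, since
  \<open>gaussian_law\<close> separates point masses from densities.\<close>

lemma gaussian_law_centered_normal:
  assumes "0 \<le> v"
  shows "gaussian_law (centered_normal v)"
proof (cases "v = 0")
  case True
  interpret real_distribution std_normal_distribution by (rule real_dist_normal_dist)
  have "centered_normal v = return borel 0"
    by (simp add: centered_normal_def True)
  then show ?thesis by (auto simp: gaussian_law_def)
next
  case False
  interpret real_distribution std_normal_distribution by (rule real_dist_normal_dist)
  from False assms have pos: "0 < sqrt v" by simp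
  have "distributed std_normal_distribution lborel (\<lambda>x. x) std_normal_density"
    by (auto simp: distributed_def distr_id2)
  from normal_density_affine[OF this zero_less_one, of "sqrt v" 0] pos
  have "distributed std_normal_distribution lborel (\<lambda>x. sqrt v * x) (normal_density 0 (sqrt v))"
    by simp
  then have "distr std_normal_distribution lborel (\<lambda>x. sqrt v * x) = density lborel (normal_density 0 (sqrt v))"
    by (simp add: distributed_def)
  moreover have "distr std_normal_distribution lborel (\<lambda>x. sqrt v * x) = centered_normal v"
    unfolding centered_normal_def by (intro distr_cong) auto
  ultimately show ?thesis using pos unfolding gaussian_law_def by metis
qed

lemma centered_normal_moments:
  assumes "0 \<le> v"
  shows "integrable (centered_normal v) (\<lambda>x. x)" "(\<integral>x. x \<partial>centered_normal v) = 0"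
    "integrable (centered_normal v) (\<lambda>x. x\<^sup>2)" "(\<integral>x. x\<^sup>2 \<partial>centered_normal v) = v"
proof -
  have i1: "integrable std_normal_distribution (\<lambda>x. x)"
    using integrable_std_normal_distribution_moment[of 1] by simp
  have m1: "(\<integral>x. x \<partial>std_normal_distribution) = 0"
    using integral_std_normal_distribution_moment_odd[of 1] by simp
  have i2: "integrable std_normal_distribution (\<lambda>x. x\<^sup>2)"
    using integrable_std_normal_distribution_moment[of 2] by simp
  have m2: "(\<integral>x. x\<^sup>2 \<partial>std_normal_distribution) = 1"
    using std_normal_distribution_even_moments(1)[of 1] by simp
  have tr: "integrable (centered_normal v) f \<longleftrightarrow> integrable std_normal_distribution (\<lambda>x. f (sqrt v * x))"
    "(\<integral>x. f x \<partial>centered_normal v) = (\<integral>x. f (sqrt v * x) \<partial>std_normal_distribution)"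
    if "f \<in> borel_measurable borel" for f :: "real \<Rightarrow> real"
    unfolding centered_normal_def using that by (simp_all add: integrable_distr_eq integral_distr)
  have id: "(\<lambda>x::real. x) \<in> borel_measurable borel" by simp
  show "integrable (centered_normal v) (\<lambda>x. x)"
    unfolding tr(1)[OF id] by (rule integrable_mult_right[OF i1])
  show "(\<integral>x. x \<partial>centered_normal v) = 0"
    unfolding tr(2)[OF id] by (simp only: m1 integral_mult_right_zero mult_zero_right)
  have sqv: "(sqrt v * x)\<^sup>2 = v * x\<^sup>2" for x using assms by (simp add: power_mult_distrib)
  have sq: "(\<lambda>x::real. x\<^sup>2) \<in> borel_measurable borel" by simp
  show "integrable (centered_normal v) (\<lambda>x. x\<^sup>2)"
    unfolding tr(1)[OF sq] using integrable_mult_right[OF i2, of v] by (simp only: sqv)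
  show "(\<integral>x. x\<^sup>2 \<partial>centered_normal v) = v"
    unfolding tr(2)[OF sq] using m2 by (simp only: sqv integral_mult_right_zero mult_1_right)
qed

text \<open>The upper bound for \<open>exp (- y)\<close> comes from (1 + y)(1 - y + y^2) = 1 + y^3
  together with 1 + y \<le> exp y; the lower bound is the tangent line at 0.\<close>

lemma exp_minus_taylor:
  fixes y :: real
  assumes "0 \<le> y"
  shows "\<bar>1 - y - exp (- y)\<bar> \<le> y\<^sup>2"
proof -
  have "1 \<le> (1 + y) * (1 - y + y\<^sup>2)"
    using assms by (simp add: algebra_simps power2_eq_square)
  also have "\<dots> \<le> exp y * (1 - y + y\<^sup>2)"
  proof (rule mult_right_mono)
    have "1 - y + y\<^sup>2 = (y - 1/2)\<^sup>2 + 3/4" by (simp add: power2_eq_square algebra_simps)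
    then show "0 \<le> 1 - y + y\<^sup>2" by simp
  qed (simp add: exp_ge_add_one_self)
  finally have "exp (- y) \<le> 1 - y + y\<^sup>2" by (simp add: exp_minus field_simps)
  moreover have "1 - y \<le> exp (- y)" using exp_ge_add_one_self[of "- y"] by simp
  ultimately show ?thesis by simp
qed

text \<open>The characteristic functions of the summands are replaced by their second-order Taylor
  polynomials, and these by the corresponding exponentials.\<close>
lemma (in prob_space) weighted_clt:
  fixes X :: "nat \<Rightarrow> 'a \<Rightarrow> real" and w :: "nat \<Rightarrow> nat \<Rightarrow> real" and A :: "nat \<Rightarrow> nat set"
  assumes indep: "indep_vars (\<lambda>_. borel) X UNIV"
    and distr_X: "\<And>i. distr M borel (X i) = \<mu>"
    and mean: "(\<integral>x. x \<partial>\<mu>) = 0"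
    and sq: "integrable \<mu> (\<lambda>x. x\<^sup>2)" and var: "(\<integral>x. x\<^sup>2 \<partial>\<mu>) = 1"
    and fin: "\<And>n. finite (A n)"
    and w_small: "b \<longlonglongrightarrow> 0" "\<And>n. 0 \<le> b n" "\<And>n i. i \<in> A n \<Longrightarrow> \<bar>w n i\<bar> \<le> b n"
    and w_sum: "(\<lambda>n. \<Sum>i\<in>A n. (w n i)\<^sup>2) \<longlonglongrightarrow> v" and "0 \<le> v"
  shows "weak_conv_m (\<lambda>n. distr M borel (\<lambda>x. \<Sum>i\<in>A n. w n i * X i x)) (centered_normal v)"
proof (rule levy_continuity)
  have [measurable]: "X i \<in> borel_measurable M" for i
    using indep by (auto simp: indep_vars_def2)
  interpret \<mu>: real_distribution \<mu>
    by (subst distr_X[symmetric, of 0], rule real_distribution_distr) simp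
  have int1: "integrable \<mu> (\<lambda>x. x)"
    by (rule \<mu>.square_integrable_imp_integrable[OF _ sq]) simp
  show "real_distribution (distr M borel (\<lambda>x. \<Sum>i\<in>A n. w n i * X i x))" for n
    by (rule real_distribution_distr) simp
  show "real_distribution (centered_normal v)" by simp
  fix t :: real
  define \<phi> where "\<phi> n = char (distr M borel (\<lambda>x. \<Sum>i\<in>A n. w n i * X i x)) t" for n
  define S where "S n = (\<Sum>i\<in>A n. (w n i)\<^sup>2)" for n
  \<comment> \<open>Since all weights are at most \<open>b n\<close> in modulus, \<open>g n\<close>
    controls the Taylor error of every summand at once. The minimum with
    \<open>6 * x\<^sup>2\<close> allows dominated convergence with second moments only.\<close>
  define g where "g n = (\<integral>x. min (6 * x\<^sup>2) (\<bar>t\<bar> * b n * \<bar>x\<bar> ^ 3) \<partial>\<mu>)" for n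
  have intg: "integrable \<mu> (\<lambda>x. min (6 * x\<^sup>2) (c * \<bar>x\<bar> ^ 3))" if "c \<ge> 0" for c
    by (rule Bochner_Integration.integrable_bound[where f="\<lambda>x. 6 * x\<^sup>2"]) (use sq that in auto)
  have g_lim: "g \<longlonglongrightarrow> 0"
  proof -
    have "(\<lambda>n. \<integral>x. min (6 * x\<^sup>2) (\<bar>t\<bar> * \<bar>b n\<bar> * \<bar>x\<bar> ^ 3) \<partial>\<mu>) \<longlonglongrightarrow> (\<integral>x. 0 \<partial>\<mu>)"
    proof (rule integral_dominated_convergence[where w="\<lambda>x. 6 * x\<^sup>2"])
      show "AE x in \<mu>. (\<lambda>n. min (6 * x\<^sup>2) (\<bar>t\<bar> * \<bar>b n\<bar> * \<bar>x\<bar> ^ 3)) \<longlonglongrightarrow> 0"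
      proof (intro AE_I2)
        fix x :: real
        have "(\<lambda>n. min (6 * x\<^sup>2) (\<bar>t\<bar> * \<bar>b n\<bar> * \<bar>x\<bar> ^ 3)) \<longlonglongrightarrow> min (6 * x\<^sup>2) (\<bar>t\<bar> * \<bar>0\<bar> * \<bar>x\<bar> ^ 3)"
          by (intro tendsto_intros w_small(1))
        then show "(\<lambda>n. min (6 * x\<^sup>2) (\<bar>t\<bar> * \<bar>b n\<bar> * \<bar>x\<bar> ^ 3)) \<longlonglongrightarrow> 0" by simp
      qed
    qed (use sq in auto)
    then show ?thesis using w_small(2) by (simp add: g_def[abs_def])
  qed
  have \<phi>_eq: "\<phi> n = (\<Prod>i\<in>A n. char \<mu> (w n i * t))" for n
  proof -
    have "indep_vars (\<lambda>_. borel) (\<lambda>i x. w n i * X i x) (A n)"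
      by (rule indep_vars_compose2[where X=X and M'="\<lambda>_. borel"]) (auto intro: indep_vars_subset[OF indep])
    then have "\<phi> n = (\<Prod>i\<in>A n. char (distr M borel (\<lambda>x. w n i * X i x)) t)"
      unfolding \<phi>_def by (rule char_distr_sum)
    moreover have "char (distr M borel (\<lambda>x. w n i * X i x)) t = char \<mu> (w n i * t)" for i
      unfolding char_def distr_X[of i, symmetric] by (simp add: integral_distr mult_ac)
    ultimately show ?thesis by simp
  qed
  have est: "norm (\<phi> n - of_real (exp (- (S n * t\<^sup>2 / 2)))) \<le> S n * t\<^sup>2 / 6 * g n + S n * t ^ 4 * (b n)\<^sup>2" for n
  proof -
    have "exp (- (S n * t\<^sup>2 / 2)) = (\<Prod>i\<in>A n. exp (- ((w n i * t)\<^sup>2 / 2)))"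
      unfolding S_def using fin
      by (simp add: exp_sum[symmetric] sum_negf sum_divide_distrib sum_distrib_right power_mult_distrib)
    then have "norm (\<phi> n - of_real (exp (- (S n * t\<^sup>2 / 2)))) = 
       norm ((\<Prod>i\<in>A n. char \<mu> (w n i * t)) - (\<Prod>i\<in>A n. of_real (exp (- ((w n i * t)\<^sup>2 / 2)))))"
      by (simp add: \<phi>_eq)
    \<comment> \<open>Two products of numbers of modulus at most 1 differ by at most the sum of the
      differences of their factors.\<close>
    also have "\<dots> \<le> (\<Sum>i\<in>A n. norm (char \<mu> (w n i * t) - of_real (exp (- ((w n i * t)\<^sup>2 / 2)))))"
      by (rule norm_prod_diff) (auto simp: \<mu>.cmod_char_le_1)
    also have "\<dots> \<le> (\<Sum>i\<in>A n. (w n i)\<^sup>2 * (t\<^sup>2 / 6 * g n + t ^ 4 * (b n)\<^sup>2))"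
    proof (rule sum_mono)
      fix i assume i: "i \<in> A n"
      let ?u = "w n i * t"
      have u: "\<bar>?u\<bar> \<le> \<bar>t\<bar> * b n"
        using w_small(3)[OF i] by (simp add: abs_mult mult.commute mult_left_mono)
      have "norm (char \<mu> ?u - (1 - ?u\<^sup>2 * 1 / 2)) \<le> ?u\<^sup>2 / 6 * (\<integral>x. min (6 * x\<^sup>2) (\<bar>?u\<bar> * \<bar>x\<bar> ^ 3) \<partial>\<mu>)"
        by (rule \<mu>.char_approx3) (use int1 mean sq var in auto)
      also have "\<dots> \<le> ?u\<^sup>2 / 6 * g n"
        unfolding g_def using u w_small(2)[of n]
        by (intro mult_left_mono integral_mono intg min.mono mult_right_mono) auto
      finally have 1: "norm (char \<mu> ?u - of_real (1 - ?u\<^sup>2 / 2)) \<le> ?u\<^sup>2 / 6 * g n" by simp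
      have "\<bar>(1 - ?u\<^sup>2 / 2) - exp (- (?u\<^sup>2 / 2))\<bar> \<le> (?u\<^sup>2 / 2)\<^sup>2"
        by (rule exp_minus_taylor) simp
      also have "\<dots> \<le> (?u\<^sup>2)\<^sup>2" by (intro power_mono) auto
      \<comment> \<open>One factor \<open>(w n i)\<^sup>2\<close> is kept, so that summation over
        \<open>i\<close> produces the convergent \<open>S n\<close>; the other is bounded by
        \<open>(b n)\<^sup>2\<close>, which tends to 0.\<close>
      also have "\<dots> \<le> (w n i)\<^sup>2 * t ^ 4 * (b n)\<^sup>2"
      proof -
        have "(w n i)\<^sup>2 \<le> (b n)\<^sup>2" using w_small(3)[OF i] w_small(2)[of n] by (simp add: abs_le_square_iff[symmetric])
        then have "((w n i)\<^sup>2 * t ^ 4) * (w n i)\<^sup>2 \<le> ((w n i)\<^sup>2 * t ^ 4) * (b n)\<^sup>2"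
          by (intro mult_left_mono) auto
        then show ?thesis by (simp add: power_mult_distrib power2_eq_square power4_eq_xxxx mult_ac)
      qed
      finally have 2: "norm (of_real (1 - ?u\<^sup>2 / 2) - of_real (exp (- (?u\<^sup>2 / 2))) :: complex) \<le> (w n i)\<^sup>2 * t ^ 4 * (b n)\<^sup>2"
        by (simp only: of_real_diff[symmetric] norm_of_real)
      from norm_triangle_mono[OF 1 2]
      show "norm (char \<mu> ?u - of_real (exp (- (?u\<^sup>2 / 2)))) \<le> (w n i)\<^sup>2 * (t\<^sup>2 / 6 * g n + t ^ 4 * (b n)\<^sup>2)"
        by (simp add: algebra_simps power_mult_distrib)
    qed
    also have "\<dots> = S n * t\<^sup>2 / 6 * g n + S n * t ^ 4 * (b n)\<^sup>2"
      by (simp only: S_def sum_distrib_right[symmetric]) (simp add: algebra_simps)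
    finally show ?thesis .
  qed
  have S_lim: "S \<longlonglongrightarrow> v" unfolding S_def by (rule w_sum)
  have "(\<lambda>n. S n * t\<^sup>2 / 6 * g n + S n * t ^ 4 * (b n)\<^sup>2) \<longlonglongrightarrow> v * t\<^sup>2 / 6 * 0 + v * t ^ 4 * 0\<^sup>2"
    by (intro tendsto_intros S_lim g_lim w_small(1)) auto
  then have diff: "(\<lambda>n. \<phi> n - of_real (exp (- (S n * t\<^sup>2 / 2)))) \<longlonglongrightarrow> 0"
    by (intro Lim_null_comparison[OF always_eventually[OF allI[OF est]]]) simp
  have "(\<lambda>n. of_real (exp (- (S n * t\<^sup>2 / 2))) :: complex) \<longlonglongrightarrow> of_real (exp (- (v * t\<^sup>2 / 2)))"
    by (intro tendsto_intros S_lim) auto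
  from tendsto_add[OF diff this] have "\<phi> \<longlonglongrightarrow> of_real (exp (- (v * t\<^sup>2 / 2)))"
    by simp
  then show "(\<lambda>n. char (distr M borel (\<lambda>x. \<Sum>i\<in>A n. w n i * X i x)) t) \<longlonglongrightarrow> char (centered_normal v) t"
    using \<open>0 \<le> v\<close> by (simp add: char_centered_normal \<phi>_def[abs_def])
qed

section \<open>Gaussian vectors with independent increments, and blocks of indices\<close>

lemma sets_centered_normal [simp, measurable_cong]: "sets (centered_normal v) = sets borel"
  by (simp add: centered_normal_def)

lemma prob_space_centered_normal [simp]: "prob_space (centered_normal v)"
  using real_distribution_centered_normal[of v] by (simp add: real_distribution_def)

abbreviation normal_product :: "('n::finite \<Rightarrow> real) \<Rightarrow> ('n \<Rightarrow> real) measure" where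
  "normal_product v \<equiv> PiM UNIV (\<lambda>l. centered_normal (v l))"

lemma prob_space_normal_product: "prob_space (normal_product v)"
  by (rule prob_space_PiM) simp

lemma measurable_normal_product: "measurable (normal_product v) N = measurable (PiM UNIV (\<lambda>_. borel)) N"
  by (rule measurable_cong_sets[OF sets_PiM_cong refl]) auto

text \<open>Characteristic functions multiply over the independent coordinates, so the exponents,
  and with them the variances, add up.\<close>

lemma distr_normal_product:
  fixes v b :: "'n::finite \<Rightarrow> real"
  assumes v: "\<And>l. 0 \<le> v l"
  shows "distr (normal_product v) borel (\<lambda>z. \<Sum>l\<in>UNIV. b l * z l) = centered_normal (\<Sum>l\<in>UNIV. v l * (b l)\<^sup>2)"
proof (rule Levy_uniqueness)
  interpret prob_space "normal_product v" by (rule prob_space_normal_product)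
  have comp: "(\<lambda>z. b l * z l) \<in> borel_measurable (normal_product v)" for l
    by (simp add: measurable_normal_product)
  show "real_distribution (distr (normal_product v) borel (\<lambda>z. \<Sum>l\<in>UNIV. b l * z l))"
    by (rule real_distribution_distr) (simp add: measurable_normal_product)
  show "real_distribution (centered_normal (\<Sum>l\<in>UNIV. v l * (b l)\<^sup>2))" by simp
  show "char (distr (normal_product v) borel (\<lambda>z. \<Sum>l\<in>UNIV. b l * z l)) = char (centered_normal (\<Sum>l\<in>UNIV. v l * (b l)\<^sup>2))"
  proof
    fix t
    have "indep_vars (\<lambda>_. borel) (\<lambda>l z. b l * z l) UNIV"
      by (rule indep_vars_compose2[OF indep_vars_PiM_coordinates]) auto
    then have "char (distr (normal_product v) borel (\<lambda>z. \<Sum>l\<in>UNIV. b l * z l)) t =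
        (\<Prod>l\<in>UNIV. char (distr (normal_product v) borel (\<lambda>z. b l * z l)) t)"
      by (rule char_distr_sum)
    also have "\<dots> = (\<Prod>l\<in>UNIV. of_real (exp (- (v l * (b l)\<^sup>2 * t\<^sup>2 / 2))))"
    proof (rule prod.cong[OF refl])
      fix l
      have "char (distr (normal_product v) borel (\<lambda>z. b l * z l)) t = (CLINT z|normal_product v. iexp (b l * t * z l))"
        unfolding char_def using comp by (subst integral_distr) (auto simp: mult_ac)
      also have "\<dots> = (CLINT x|distr (normal_product v) (centered_normal (v l)) (\<lambda>z. z l). iexp (b l * t * x))"
        by (subst integral_distr) auto
      also have "\<dots> = char (centered_normal (v l)) (b l * t)"
        unfolding char_def by (subst distr_PiM_component) auto
      finally show "char (distr (normal_product v) borel (\<lambda>z. b l * z l)) t = of_real (exp (- (v l * (b l)\<^sup>2 * t\<^sup>2 / 2)))"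
        by (simp add: char_centered_normal v power_mult_distrib mult_ac)
    qed
    also have "\<dots> = of_real (exp (- ((\<Sum>l\<in>UNIV. v l * (b l)\<^sup>2) * t\<^sup>2 / 2)))"
      by (simp add: exp_sum[symmetric] sum_negf sum_divide_distrib sum_distrib_right flip: of_real_prod)
    also have "\<dots> = char (centered_normal (\<Sum>l\<in>UNIV. v l * (b l)\<^sup>2)) t"
      by (rule char_centered_normal[symmetric]) (simp add: v sum_nonneg)
    finally show "char (distr (normal_product v) borel (\<lambda>z. \<Sum>l\<in>UNIV. b l * z l)) t = char (centered_normal (\<Sum>l\<in>UNIV. v l * (b l)\<^sup>2)) t" .
  qed
qed

text \<open>The linear form has a \<open>centered_normal\<close> law, so these are moments of a
  single real variable.\<close>

lemma normal_product_moments: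
  fixes v b :: "'n::finite \<Rightarrow> real"
  assumes v: "\<And>l. 0 \<le> v l"
  shows "(\<integral>z. (\<Sum>l\<in>UNIV. b l * z l) \<partial>normal_product v) = 0"
    "integrable (normal_product v) (\<lambda>z. (\<Sum>l\<in>UNIV. b l * z l)\<^sup>2)"
    "(\<integral>z. (\<Sum>l\<in>UNIV. b l * z l)\<^sup>2 \<partial>normal_product v) = (\<Sum>l\<in>UNIV. v l * (b l)\<^sup>2)"
proof -
  have L: "(\<lambda>z. \<Sum>l\<in>UNIV. b l * z l) \<in> borel_measurable (normal_product v)"
    by (simp add: measurable_normal_product)
  have "0 \<le> (\<Sum>l\<in>UNIV. v l * (b l)\<^sup>2)" by (simp add: v sum_nonneg)
  note m = centered_normal_moments[OF this, folded distr_normal_product[of v b, OF v]]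
  have sq: "(\<lambda>x::real. x\<^sup>2) \<in> borel_measurable borel" by simp
  show "(\<integral>z. (\<Sum>l\<in>UNIV. b l * z l) \<partial>normal_product v) = 0"
    using m(2) by (subst (asm) integral_distr[OF L]) auto
  show "integrable (normal_product v) (\<lambda>z. (\<Sum>l\<in>UNIV. b l * z l)\<^sup>2)"
    using m(3) unfolding integrable_distr_eq[OF L sq] .
  show "(\<integral>z. (\<Sum>l\<in>UNIV. b l * z l)\<^sup>2 \<partial>normal_product v) = (\<Sum>l\<in>UNIV. v l * (b l)\<^sup>2)"
    using m(4) unfolding integral_distr[OF L sq] .
qed

text \<open>Polarisation reduces the mixed moment to the second moments of the linear forms with
  coefficients b + c, b and c.\<close>

lemma normal_product_covariance:
  fixes v b c :: "'n::finite \<Rightarrow> real"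
  assumes v: "\<And>l. 0 \<le> v l"
  shows "(\<integral>z. (\<Sum>l\<in>UNIV. b l * z l) * (\<Sum>l\<in>UNIV. c l * z l) \<partial>normal_product v) = (\<Sum>l\<in>UNIV. v l * (b l * c l))"
proof -
  have polar: "(\<Sum>l\<in>UNIV. b l * z l) * (\<Sum>l\<in>UNIV. c l * z l) =
      ((\<Sum>l\<in>UNIV. (b l + c l) * z l)\<^sup>2 - (\<Sum>l\<in>UNIV. b l * z l)\<^sup>2 - (\<Sum>l\<in>UNIV. c l * z l)\<^sup>2) / 2" for z
    by (simp add: distrib_right sum.distrib power2_eq_square algebra_simps)
  have "(\<integral>z. (\<Sum>l\<in>UNIV. b l * z l) * (\<Sum>l\<in>UNIV. c l * z l) \<partial>normal_product v) =
     ((\<Sum>l\<in>UNIV. v l * (b l + c l)\<^sup>2) - (\<Sum>l\<in>UNIV. v l * (b l)\<^sup>2) - (\<Sum>l\<in>UNIV. v l * (c l)\<^sup>2)) / 2"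
    unfolding polar using normal_product_moments[of v, OF v] by simp
  also have "\<dots> = (\<Sum>l\<in>UNIV. (v l * (b l + c l)\<^sup>2 - v l * (b l)\<^sup>2 - v l * (c l)\<^sup>2) / 2)"
    by (simp add: sum_subtractf sum_divide_distrib[symmetric])
  also have "\<dots> = (\<Sum>l\<in>UNIV. v l * (b l * c l))"
    by (intro sum.cong) (auto simp: power2_eq_square algebra_simps)
  finally show ?thesis .
qed

text \<open>The continuous map that takes the independent block sums to the vector of values at the
  times \<open>t m\<close>. The finite linear order \<open>'n\<close> plays the role of 1, ...,
  N.\<close>

definition partial_sums :: "('n::{finite, linorder} \<Rightarrow> real) \<Rightarrow> real ^ 'n::{finite, linorder}" where
  "partial_sums z = (\<chi> m. \<Sum>l\<in>{..m}. z l)"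

lemma borel_measurable_vec:
  fixes f :: "'a \<Rightarrow> real ^ 'n"
  assumes "\<And>i. (\<lambda>x. f x $ i) \<in> borel_measurable M"
  shows "f \<in> borel_measurable M"
  using assms by (subst borel_measurable_euclidean_space) (auto simp: Basis_vec_def inner_axis)

lemma partial_sums_measurable: "partial_sums \<in> borel_measurable (PiM UNIV (\<lambda>_. borel))"
  by (rule borel_measurable_vec) (simp add: partial_sums_def)

lemma tendsto_partial_sums:
  assumes "\<And>l. (\<lambda>n. z n l) \<longlonglongrightarrow> z' l"
  shows "(\<lambda>n. partial_sums (z n)) \<longlonglongrightarrow> partial_sums z'"
  unfolding partial_sums_def by (intro vec_tendstoI) (simp add: assms tendsto_sum)

text \<open>Interchanging the two sums exhibits every linear functional of the vector as a linear
  form in the independent coordinates, and hence as a normal variable under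
  \<open>normal_product\<close>.\<close>

lemma inner_partial_sums:
  fixes a :: "real ^ 'n::{finite, linorder}"
  shows "a \<bullet> partial_sums z = (\<Sum>l\<in>UNIV. (\<Sum>m\<in>{l..}. a $ m) * z l)"
proof -
  have "a \<bullet> partial_sums z = (\<Sum>m\<in>UNIV. \<Sum>l\<in>UNIV. if l \<le> m then a $ m * z l else 0)"
    by (simp add: inner_vec_def partial_sums_def sum_distrib_left sum.If_cases Collect_conv_if)
       (simp add: atMost_def)
  also have "\<dots> = (\<Sum>l\<in>UNIV. \<Sum>m\<in>UNIV. if l \<le> m then a $ m * z l else 0)"
    by (rule sum.swap)
  also have "\<dots> = (\<Sum>l\<in>UNIV. (\<Sum>m\<in>{l..}. a $ m) * z l)"
    by (simp add: sum_distrib_right sum.If_cases) (simp add: atLeast_def)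
  finally show ?thesis .
qed

definition partial_sums_law :: "('n::{finite, linorder} \<Rightarrow> real) \<Rightarrow> (real ^ 'n::{finite, linorder}) measure" where
  "partial_sums_law v = distr (normal_product v) borel partial_sums"

lemma multivariate_gaussian_partial_sums_law:
  fixes v :: "'n::{finite, linorder} \<Rightarrow> real"
  assumes v: "\<And>l. 0 \<le> v l"
  shows "multivariate_gaussian (partial_sums_law v)"
  unfolding multivariate_gaussian_def
proof (intro conjI allI)
  interpret prob_space "normal_product v" by (rule prob_space_normal_product)
  have meas: "partial_sums \<in> borel_measurable (normal_product v)"
    using partial_sums_measurable by (simp add: measurable_normal_product)
  show "prob_space (partial_sums_law v)"
    unfolding partial_sums_law_def by (rule prob_space_distr[OF meas])
  show "sets (partial_sums_law v) = sets borel" by (simp add: partial_sums_law_def)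
  fix a :: "real ^ 'n::{finite, linorder}"
  have "distr (partial_sums_law v) borel (\<lambda>x. a \<bullet> x) = centered_normal (\<Sum>l\<in>UNIV. v l * (\<Sum>m\<in>{l..}. a $ m)\<^sup>2)"
    unfolding partial_sums_law_def
    by (subst distr_distr[OF _ meas]) (auto simp: comp_def inner_partial_sums distr_normal_product v)
  then show "gaussian_law (distr (partial_sums_law v) borel (\<lambda>x. a \<bullet> x))"
    by (simp add: gaussian_law_centered_normal v sum_nonneg)
qed

text \<open>Coordinate \<open>i\<close> is the linear form with coefficients 1 up to
  \<open>i\<close> and 0 beyond. The product of two such coefficient vectors is 1 exactly up to the
  smaller index.\<close>

lemma partial_sums_law_moments:
  fixes v :: "'n::{finite, linorder} \<Rightarrow> real"
  assumes v: "\<And>l. 0 \<le> v l"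
  shows "(\<integral>z. z $ i \<partial>partial_sums_law v) = 0"
    and "(\<integral>z. z $ i * z $ j \<partial>partial_sums_law v) = (\<Sum>l\<in>{..min i j}. v l)"
proof -
  have meas: "partial_sums \<in> borel_measurable (normal_product v)"
    using partial_sums_measurable by (simp add: measurable_normal_product)
  have comp: "partial_sums z $ m = (\<Sum>l\<in>UNIV. of_bool (l \<le> m) * z l)" for z and m :: 'n
    by (simp add: partial_sums_def of_bool_def if_distrib[of "\<lambda>c. c * _"] sum.If_cases cong: if_cong)
       (simp add: atMost_def)
  have nth[measurable]: "(\<lambda>z::real ^ 'n::{finite, linorder}. z $ m) \<in> borel_measurable borel" for m
    by (intro borel_measurable_continuous_onI continuous_intros)
  show "(\<integral>z. z $ i \<partial>partial_sums_law v) = 0"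
    unfolding partial_sums_law_def integral_distr[OF meas nth] comp by (rule normal_product_moments(1)[OF v])
  have nth2: "(\<lambda>z::real ^ 'n::{finite, linorder}. z $ i * z $ j) \<in> borel_measurable borel" by measurable
  have "(\<integral>z. z $ i * z $ j \<partial>partial_sums_law v) = (\<Sum>l\<in>UNIV. v l * (of_bool (l \<le> i) * of_bool (l \<le> j)))"
    unfolding partial_sums_law_def integral_distr[OF meas nth2] comp by (rule normal_product_covariance[OF v])
  also have "\<dots> = (\<Sum>l\<in>UNIV. if l \<le> min i j then v l else 0)"
    by (intro sum.cong) auto
  also have "\<dots> = (\<Sum>l\<in>{..min i j}. v l)"
    by (simp only: sum.If_cases finite) (simp add: atMost_def)
  finally show "(\<integral>z. z $ i * z $ j \<partial>partial_sums_law v) = (\<Sum>l\<in>{..min i j}. v l)" .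
qed

text \<open>For monotone \<open>K\<close> this is the interval from the value of \<open>K\<close> at the predecessor of \<open>l\<close> (or \<open>0\<close>) to \<open>K l\<close>.\<close>
definition block :: "('n::{finite, linorder} \<Rightarrow> nat) \<Rightarrow> 'n \<Rightarrow> nat set" where
  "block K l = {i. i < K l \<and> (\<forall>m<l. K m \<le> i)}"

lemma finite_block [simp]: "finite (block K l)"
  by (rule finite_subset[of _ "{..<K l}"]) (auto simp: block_def)

lemma block_less: "i \<in> block K l \<Longrightarrow> i < K l"
  and block_ge: "i \<in> block K l \<Longrightarrow> m < l \<Longrightarrow> K m \<le> i"
  by (auto simp: block_def)

lemma disjoint_block: "disjoint_family (block K)"
proof (unfold disjoint_family_on_def, safe)
  fix l m i assume "l \<noteq> m" "i \<in> block K l" "i \<in> block K m"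
  then show "i \<in> {}" by (meson linorder_neqE leD block_less block_ge)
qed

lemma UN_block:
  assumes "mono K"
  shows "(\<Union>l\<in>{..m}. block K l) = {..<K m}"
proof safe
  fix i l assume "l \<le> m" "i \<in> block K l"
  then show "i < K m" using monoD[OF assms, of l m] by (auto simp: block_def)
next
  fix i assume i: "i < K m"
  \<comment> \<open>The block containing \<open>i\<close> is that of the first \<open>l\<close> with
    \<open>i < K l\<close>; minimality gives the lower bounds in the definition of
    \<open>block\<close>.\<close>
  define l where "l = Min {l. i < K l}"
  have "l \<in> {l. i < K l}" unfolding l_def using i by (intro Min_in) auto
  moreover have "l \<le> m'" if "i < K m'" for m' unfolding l_def using that by (intro Min_le) auto
  ultimately have "i \<in> block K l" "l \<le> m" using i by (auto simp: block_def intro: leI dest: leD)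
  then show "i \<in> (\<Union>l\<in>{..m}. block K l)" by auto
qed

text \<open>Used twice: for the random sums themselves and for their squared weights, that is, their
  variances.\<close>

lemma sum_blocks:
  assumes "mono K"
  shows "(\<Sum>l\<in>{..m}. \<Sum>i\<in>block K l. g i) = (\<Sum>i<K m. g i)"
  unfolding UN_block[OF assms, symmetric]
  by (rule sum.UNION_disjoint[symmetric]) (use disjoint_block[of K] in \<open>auto simp: disjoint_family_on_def\<close>)

text \<open>Block variances are differences of cumulative variances, whose limits are known. The
  limits of the single blocks therefore exist and need not be computed.\<close>

lemma tendsto_from_partial_sums:
  fixes V :: "nat \<Rightarrow> 'n::{finite, linorder} \<Rightarrow> real"
  assumes lim: "\<And>m. (\<lambda>n. \<Sum>l\<in>{..m}. V n l) \<longlonglongrightarrow> T m"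
  shows "\<exists>v. (\<forall>l. (\<lambda>n. V n l) \<longlonglongrightarrow> v l) \<and> (\<forall>m. (\<Sum>l\<in>{..m}. v l) = T m)"
proof -
  have conv: "convergent (\<lambda>n. V n m)" for m
  \<comment> \<open>Induction on the number of smaller indices makes it unnecessary to speak of a
    predecessor of \<open>m\<close>.\<close>
  proof (induction "card {..<m}" arbitrary: m rule: less_induct)
    case less
    have IH: "convergent (\<lambda>n. V n l)" if "l \<in> {..<m}" for l
      using that by (intro less psubset_card_mono) auto
    have "{..m} = insert m {..<m}" by auto
    then have "(\<lambda>n. (\<Sum>l\<in>{..m}. V n l) - (\<Sum>l\<in>{..<m}. V n l)) = (\<lambda>n. V n m)"
      by (simp add: fun_eq_iff)
    moreover have "convergent (\<lambda>n. (\<Sum>l\<in>{..m}. V n l) - (\<Sum>l\<in>{..<m}. V n l))"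
      using IH by (intro convergent_diff[OF convergentI[OF lim]] convergent_sum) auto
    ultimately show ?case by simp
  qed
  then have "\<forall>l. \<exists>L. (\<lambda>n. V n l) \<longlonglongrightarrow> L" by (auto simp: convergent_def)
  then obtain v where v: "\<And>l. (\<lambda>n. V n l) \<longlonglongrightarrow> v l" by metis
  have "(\<Sum>l\<in>{..m}. v l) = T m" for m
    by (rule LIMSEQ_unique[OF _ lim]) (intro tendsto_sum v)
  with v show ?thesis by blast
qed

section \<open>Second-moment estimates\<close>

text \<open>A Slutsky argument through second moments. The bound \<open>C\<close> makes the laws of
  \<open>X n\<close> tight, so that uniform continuity of \<open>f\<close> on a compact ball is
  enough; \<open>X n\<close> itself need not converge.\<close>

lemma (in prob_space) expectation_perturbation_tendsto:
  fixes X R :: "nat \<Rightarrow> 'a \<Rightarrow> 'b::euclidean_space" and f :: "'b \<Rightarrow> real"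
  assumes [measurable]: "\<And>n. X n \<in> borel_measurable M" "\<And>n. R n \<in> borel_measurable M"
    and X_sq: "\<And>n. integrable M (\<lambda>x. (norm (X n x))\<^sup>2)"
    and X_bound: "\<And>n. (\<integral>x. (norm (X n x))\<^sup>2 \<partial>M) \<le> C"
    and R_sq: "\<And>n. integrable M (\<lambda>x. (norm (R n x))\<^sup>2)"
    and R_lim: "(\<lambda>n. \<integral>x. (norm (R n x))\<^sup>2 \<partial>M) \<longlonglongrightarrow> 0"
    and cont: "continuous_on UNIV f" and bdd: "bounded (range f)"
  shows "(\<lambda>n. (\<integral>x. f (X n x + R n x) \<partial>M) - (\<integral>x. f (X n x) \<partial>M)) \<longlonglongrightarrow> 0"
proof (rule LIMSEQ_I)
  fix e :: real assume e: "0 < e"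
  have [measurable]: "f \<in> borel_measurable borel"
    using cont by (rule borel_measurable_continuous_onI)
  obtain B where "0 < B" and B: "\<And>z. \<bar>f z\<bar> \<le> B"
    using bdd by (auto simp: bounded_pos)
  have "0 \<le> C" using order_trans[OF _ X_bound[of 0], of 0] by simp
  \<comment> \<open>Chosen so that 2 B (C + 1) / K^2 = e / 3. Using C + 1 in place of C keeps
    \<open>K\<close> positive when C = 0.\<close>
  define K where "K = sqrt (6 * B * (C + 1) / e)"
  have K: "0 < K" "K\<^sup>2 = 6 * B * (C + 1) / e"
    using e \<open>0 < B\<close> \<open>0 \<le> C\<close> by (auto simp: K_def)
  \<comment> \<open>The radius exceeds \<open>K\<close> by 1 because \<open>u + v\<close> must stay
    in the ball when \<open>norm u \<le> K\<close> and \<open>norm v < d \<le> 1\<close>.\<close>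
  have "uniformly_continuous_on (cball 0 (K + 1)) f"
    by (rule compact_uniformly_continuous) (auto intro: continuous_on_subset[OF cont])
  then obtain d' where d': "0 < d'"
    "\<And>x y. x \<in> cball 0 (K + 1) \<Longrightarrow> y \<in> cball 0 (K + 1) \<Longrightarrow> dist y x < d' \<Longrightarrow> dist (f y) (f x) < e / 3"
    using e unfolding uniformly_continuous_on_def by (metis zero_less_divide_iff zero_less_numeral)
  define d where "d = min d' 1"
  have d: "0 < d" "d \<le> d'" "d \<le> 1" using d' by (auto simp: d_def)
  \<comment> \<open>Chebyshev's inequality in pointwise form: where \<open>u\<close> or
    \<open>v\<close> is large, the trivial bound 2 B is dominated by a quadratic term, so
    integration replaces estimates of probabilities.\<close>
  have pt: "\<bar>f (u + v) - f u\<bar> \<le> e / 3 + 2 * B / K\<^sup>2 * (norm u)\<^sup>2 + 2 * B / d\<^sup>2 * (norm v)\<^sup>2" for u v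
  proof -
    have trivial_bound: "\<bar>f (u + v) - f u\<bar> \<le> 2 * B" using B[of "u + v"] B[of u] by linarith
    have nn: "0 \<le> 2 * B / K\<^sup>2 * (norm u)\<^sup>2" "0 \<le> 2 * B / d\<^sup>2 * (norm v)\<^sup>2"
      using \<open>0 < B\<close> by auto
    have large: "2 * B \<le> 2 * B / c\<^sup>2 * r\<^sup>2" if "0 < c" "c \<le> r" for c r :: real
    proof -
      have "c\<^sup>2 \<le> r\<^sup>2" using that by (intro power_mono) auto
      then show ?thesis using that \<open>0 < B\<close> by (simp add: field_simps)
    qed
    consider "K < norm u" | "d \<le> norm v" | "norm u \<le> K" "norm v < d" by linarith
    then show ?thesis
    proof cases
      case 1
      then have "2 * B \<le> 2 * B / K\<^sup>2 * (norm u)\<^sup>2" using K(1) by (intro large) auto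
      then show ?thesis using trivial_bound nn e by linarith
    next
      case 2
      then have "2 * B \<le> 2 * B / d\<^sup>2 * (norm v)\<^sup>2" using d(1) by (intro large) auto
      then show ?thesis using trivial_bound nn e by linarith
    next
      case 3
      have "dist (f (u + v)) (f u) < e / 3"
      proof (rule d'(2))
        show "u \<in> cball 0 (K + 1)" using 3 by simp
        have "norm (u + v) \<le> K + 1" using norm_triangle_ineq[of u v] 3 d(3) by linarith
        then show "u + v \<in> cball 0 (K + 1)" by simp
        show "dist (u + v) u < d'" using 3 d(2) by (simp add: dist_norm)
      qed
      then show ?thesis using nn unfolding dist_real_def by linarith
    qed
  qed
  have "\<forall>\<^sub>F n in sequentially. 2 * B / d\<^sup>2 * (\<integral>x. (norm (R n x))\<^sup>2 \<partial>M) < e / 3"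
    using tendsto_mult_right_zero[OF R_lim, of "2 * B / d\<^sup>2"] e by (intro order_tendstoD) auto
  then obtain N where N: "\<And>n. N \<le> n \<Longrightarrow> 2 * B / d\<^sup>2 * (\<integral>x. (norm (R n x))\<^sup>2 \<partial>M) < e / 3"
    by (auto simp: eventually_sequentially)
  have "norm ((\<integral>x. f (X n x + R n x) \<partial>M) - (\<integral>x. f (X n x) \<partial>M) - 0) < e" if "N \<le> n" for n
  proof -
    have int: "integrable M (\<lambda>x. f (X n x + R n x))" "integrable M (\<lambda>x. f (X n x))"
      by (auto intro!: integrable_const_bound[where B=B] simp: B)
    have "norm ((\<integral>x. f (X n x + R n x) \<partial>M) - (\<integral>x. f (X n x) \<partial>M)) = norm (\<integral>x. f (X n x + R n x) - f (X n x) \<partial>M)"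
      using int by simp
    also have "\<dots> \<le> (\<integral>x. norm (f (X n x + R n x) - f (X n x)) \<partial>M)"
      by (rule integral_norm_bound)
    also have "\<dots> \<le> (\<integral>x. e / 3 + 2 * B / K\<^sup>2 * (norm (X n x))\<^sup>2 + 2 * B / d\<^sup>2 * (norm (R n x))\<^sup>2 \<partial>M)"
      using int X_sq[of n] R_sq[of n] pt by (intro integral_mono) auto
    also have "\<dots> = e / 3 + 2 * B / K\<^sup>2 * (\<integral>x. (norm (X n x))\<^sup>2 \<partial>M) + 2 * B / d\<^sup>2 * (\<integral>x. (norm (R n x))\<^sup>2 \<partial>M)"
      using X_sq[of n] R_sq[of n] by (simp add: prob_space)
    also have "\<dots> < e / 3 + e / 3 + e / 3"
    proof -
      have "2 * B / K\<^sup>2 * (\<integral>x. (norm (X n x))\<^sup>2 \<partial>M) \<le> 2 * B / K\<^sup>2 * (C + 1)"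
        using X_bound[of n] \<open>0 < B\<close> by (intro mult_left_mono) auto
      also have "\<dots> = e / 3"
      proof -
        have "B \<noteq> 0" "C + 1 \<noteq> 0" "e \<noteq> 0" using e \<open>0 < B\<close> \<open>0 \<le> C\<close> by auto
        then show ?thesis unfolding K(2) by (simp add: divide_simps)
      qed
      finally show ?thesis using N[OF that] by linarith
    qed
    finally show ?thesis by simp
  qed
  then show "\<exists>no. \<forall>n\<ge>no. norm ((\<integral>x. f (X n x + R n x) \<partial>M) - (\<integral>x. f (X n x) \<partial>M) - 0) < e"
    by blast
qed

section \<open>Square-integrable functions of the past and orthogonal increments\<close>

lemma integrable_mult_of_squares:
  fixes u v :: "'a \<Rightarrow> real"
  assumes [measurable]: "u \<in> borel_measurable M" "v \<in> borel_measurable M"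
    and "integrable M (\<lambda>x. (u x)\<^sup>2)" "integrable M (\<lambda>x. (v x)\<^sup>2)"
  shows "integrable M (\<lambda>x. u x * v x)"
proof (rule Bochner_Integration.integrable_bound[where f="\<lambda>x. (u x)\<^sup>2 + (v x)\<^sup>2"])
  show "AE x in M. norm (u x * v x) \<le> norm ((u x)\<^sup>2 + (v x)\<^sup>2)"
  proof (intro AE_I2)
    fix x
    have "2 * (\<bar>u x\<bar> * \<bar>v x\<bar>) \<le> (u x)\<^sup>2 + (v x)\<^sup>2"
      using sum_squares_bound[of "\<bar>u x\<bar>" "\<bar>v x\<bar>"] by simp
    moreover have "0 \<le> \<bar>u x\<bar> * \<bar>v x\<bar>" by simp
    ultimately have "\<bar>u x\<bar> * \<bar>v x\<bar> \<le> (u x)\<^sup>2 + (v x)\<^sup>2" by linarith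
    then show "norm (u x * v x) \<le> norm ((u x)\<^sup>2 + (v x)\<^sup>2)" by (simp add: abs_mult)
  qed
qed (use assms in auto)

text \<open>Stands in for measurability with respect to the first \<open>k\<close> innovations. It
  is a property of functions on real sequences, so that it can be checked along a deterministic
  recursion before the noise is inserted.\<close>

definition past :: "nat \<Rightarrow> ((nat \<Rightarrow> real) \<Rightarrow> real) \<Rightarrow> bool" where
  "past k h \<longleftrightarrow> h \<in> borel_measurable (PiM UNIV (\<lambda>_. borel)) \<and>
     (\<forall>e e'. (\<forall>i<k. e i = e' i) \<longrightarrow> h e = h e')"

lemma past_measurable: "past k h \<Longrightarrow> h \<in> borel_measurable (PiM UNIV (\<lambda>_. borel))"
  by (simp add: past_def)

lemma past_const [intro]: "past k (\<lambda>_. c)"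
  by (simp add: past_def)

lemma past_coordinate [intro]: "i < k \<Longrightarrow> past k (\<lambda>e. e i)"
  by (simp add: past_def)

lemma past_Suc [intro]: "past k h \<Longrightarrow> past (Suc k) h"
  unfolding past_def by (meson less_SucI)

lemma past_binop:
  assumes "past k g" "past k h"
  shows past_add: "past k (\<lambda>e. g e + h e)" and past_mult: "past k (\<lambda>e. g e * h e)"
  using assms unfolding past_def by (auto, metis+)

text \<open>Overwriting the coordinates from \<open>k\<close> on by 0 does not change
  \<open>h\<close>, so \<open>h\<close> is a function of the restriction to \<open>{..<k}\<close>.
  Restrictions to the disjoint sets \<open>{..<k}\<close> and \<open>{k}\<close> are
  independent.\<close>

lemma (in prob_space) indep_var_past:
  assumes indep: "indep_vars (\<lambda>_. borel) X UNIV" and h: "past k h"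
  shows "indep_var borel (\<lambda>\<omega>. h (\<lambda>i. X i \<omega>)) borel (X k)"
proof -
  note [measurable] = past_measurable[OF h]
  have "indep_var borel ((\<lambda>e. h (\<lambda>i. if i < k then e i else 0)) \<circ> (\<lambda>\<omega>. restrict (\<lambda>i. X i \<omega>) {..<k}))
     borel ((\<lambda>e. e k) \<circ> (\<lambda>\<omega>. restrict (\<lambda>i. X i \<omega>) {k}))"
  proof (rule indep_var_compose[OF indep_var_restrict[OF indep]])
    have "(\<lambda>e i. if i < k then e i else 0) \<in> measurable (PiM {..<k} (\<lambda>_. borel :: real measure)) (PiM UNIV (\<lambda>_. borel))"
    proof (rule measurable_PiM_single')
      show "(\<lambda>e. if i < k then e i else 0) \<in> borel_measurable (PiM {..<k} (\<lambda>_. borel :: real measure))" for i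
        by (cases "i < k") auto
    qed auto
    then show "(\<lambda>e. h (\<lambda>i. if i < k then e i else 0)) \<in> borel_measurable (PiM {..<k} (\<lambda>_. borel))"
      by (rule measurable_compose) measurable
  qed auto
  moreover have "(\<lambda>e. h (\<lambda>i. if i < k then e i else 0)) \<circ> (\<lambda>\<omega>. restrict (\<lambda>i. X i \<omega>) {..<k}) = (\<lambda>\<omega>. h (\<lambda>i. X i \<omega>))"
    using h unfolding past_def by (auto simp: fun_eq_iff)
  moreover have "(\<lambda>e. e k) \<circ> (\<lambda>\<omega>. restrict (\<lambda>i. X i \<omega>) {k}) = X k" by auto
  ultimately show ?thesis by simp
qed

locale centered_iid = prob_space +
  fixes X :: "nat \<Rightarrow> 'a \<Rightarrow> real" and s2 :: real
  assumes indep: "indep_vars (\<lambda>_. borel) X UNIV"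
    and X_mean: "\<And>k. (\<integral>x. X k x \<partial>M) = 0"
    and X_sq: "\<And>k. integrable M (\<lambda>x. (X k x)\<^sup>2)"
    and X_var: "\<And>k. (\<integral>x. (X k x)\<^sup>2 \<partial>M) = s2"
begin

lemma X_measurable [measurable]: "X k \<in> borel_measurable M"
  using indep by (auto simp: indep_vars_def2)

lemma s2_nonneg: "0 \<le> s2"
  using X_var[of 0] by (metis integral_nonneg_AE AE_I2 zero_le_power2)

lemma X_integrable: "integrable M (X k)"
  using X_sq by (rule square_integrable_imp_integrable[rotated]) simp

lemma past_process_measurable:
  assumes "past k h"
  shows "(\<lambda>\<omega>. h (\<lambda>i. X i \<omega>)) \<in> borel_measurable M"
  by (rule measurable_compose[OF _ past_measurable[OF assms]], rule measurable_PiM_single') auto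

text \<open>Both \<open>u * v\<close> and \<open>v\<^sup>2\<close> are functions of the past.
  Independence of \<open>X k\<close> removes the cross term, as \<open>X k\<close> has mean 0, and
  factorises the expectation of the squared increment.\<close>

lemma orthogonal_increment:
  assumes u: "past k u" and v: "past k v"
    and u_sq: "integrable M (\<lambda>\<omega>. (u (\<lambda>i. X i \<omega>))\<^sup>2)" and v_sq: "integrable M (\<lambda>\<omega>. (v (\<lambda>i. X i \<omega>))\<^sup>2)"
  shows "integrable M (\<lambda>\<omega>. (u (\<lambda>i. X i \<omega>) + v (\<lambda>i. X i \<omega>) * X k \<omega>)\<^sup>2)"
    and "(\<integral>\<omega>. (u (\<lambda>i. X i \<omega>) + v (\<lambda>i. X i \<omega>) * X k \<omega>)\<^sup>2 \<partial>M) =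
      (\<integral>\<omega>. (u (\<lambda>i. X i \<omega>))\<^sup>2 \<partial>M) + s2 * (\<integral>\<omega>. (v (\<lambda>i. X i \<omega>))\<^sup>2 \<partial>M)"
proof -
  define U V where "U = (\<lambda>\<omega>. u (\<lambda>i. X i \<omega>))" and "V = (\<lambda>\<omega>. v (\<lambda>i. X i \<omega>))"
  have [measurable]: "U \<in> borel_measurable M" "V \<in> borel_measurable M"
    unfolding U_def V_def using u v by (auto intro: past_process_measurable)
  have iU: "integrable M (\<lambda>\<omega>. (U \<omega>)\<^sup>2)" and iV: "integrable M (\<lambda>\<omega>. (V \<omega>)\<^sup>2)"
    using u_sq v_sq by (auto simp: U_def V_def)
  have iUV: "integrable M (\<lambda>\<omega>. U \<omega> * V \<omega>)"
    by (rule integrable_mult_of_squares) (use iU iV in auto)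
  have ind1: "indep_var borel (\<lambda>\<omega>. U \<omega> * V \<omega>) borel (X k)"
    unfolding U_def V_def by (rule indep_var_past[OF indep past_mult[OF u v]])
  have "indep_var borel V borel (X k)"
    unfolding V_def by (rule indep_var_past[OF indep v])
  then have "indep_var borel ((\<lambda>x. x\<^sup>2) \<circ> V) borel ((\<lambda>x. x\<^sup>2) \<circ> X k)"
    by (rule indep_var_compose) auto
  then have ind2: "indep_var borel (\<lambda>\<omega>. (V \<omega>)\<^sup>2) borel (\<lambda>\<omega>. (X k \<omega>)\<^sup>2)" by (simp add: comp_def)
  note cross = indep_var_integrable[OF ind1 iUV X_integrable] indep_var_lebesgue_integral[OF ind1 iUV X_integrable]
  note square = indep_var_integrable[OF ind2 iV X_sq] indep_var_lebesgue_integral[OF ind2 iV X_sq]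
  have expand: "(U \<omega> + V \<omega> * X k \<omega>)\<^sup>2 = (U \<omega>)\<^sup>2 + 2 * (U \<omega> * V \<omega> * X k \<omega>) + (V \<omega>)\<^sup>2 * (X k \<omega>)\<^sup>2" for \<omega>
    by (simp add: power2_eq_square algebra_simps)
  have "integrable M (\<lambda>\<omega>. (U \<omega> + V \<omega> * X k \<omega>)\<^sup>2)"
    unfolding expand using iU cross(1) square(1) by auto
  then show "integrable M (\<lambda>\<omega>. (u (\<lambda>i. X i \<omega>) + v (\<lambda>i. X i \<omega>) * X k \<omega>)\<^sup>2)"
    by (simp add: U_def V_def)
  have "(\<integral>\<omega>. (U \<omega> + V \<omega> * X k \<omega>)\<^sup>2 \<partial>M) = (\<integral>\<omega>. (U \<omega>)\<^sup>2 \<partial>M) + s2 * (\<integral>\<omega>. (V \<omega>)\<^sup>2 \<partial>M)"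
    unfolding expand using iU cross square by (simp add: X_mean X_var)
  then show "(\<integral>\<omega>. (u (\<lambda>i. X i \<omega>) + v (\<lambda>i. X i \<omega>) * X k \<omega>)\<^sup>2 \<partial>M) =
      (\<integral>\<omega>. (u (\<lambda>i. X i \<omega>))\<^sup>2 \<partial>M) + s2 * (\<integral>\<omega>. (v (\<lambda>i. X i \<omega>))\<^sup>2 \<partial>M)"
    by (simp add: U_def V_def)
qed

end

text \<open>\<open>garch_dev a c e k\<close> is \<open>\<sigma>\<^sub>k\<^sup>2 / \<omega> - k\<close> when \<open>\<alpha> = a\<close>, \<open>\<beta> = 1 - a\<close>, \<open>\<sigma>\<^sub>0\<^sup>2 / \<omega> = c\<close> and \<open>e\<close> is the sequence
  of the \<open>\<xi>\<^sub>j\<close>.\<close>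
primrec garch_dev :: "real \<Rightarrow> real \<Rightarrow> (nat \<Rightarrow> real) \<Rightarrow> nat \<Rightarrow> real" where
  "garch_dev a c e 0 = c"
| "garch_dev a c e (Suc k) = garch_dev a c e k + a * (real k + garch_dev a c e k) * e k"

text \<open>As a + b = 1, the recursion adds \<omega> and multiplies the squared volatility by
  \<open>1 + a * ((e k)\<^sup>2 - 1)\<close>. Nonnegative coefficients make the radicand
  nonnegative, so squaring undoes the root.\<close>

lemma garch_sigma_eq_dev:
  assumes "0 < \<omega>" "0 \<le> a" "0 \<le> b" "a + b = 1"
  shows "(garch_sigma \<omega> a b s0 e k)\<^sup>2 / \<omega> - real k = garch_dev a (s0\<^sup>2 / \<omega>) (\<lambda>i. (e i)\<^sup>2 - 1) k"
proof (induction k)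
  case (Suc k)
  define s where "s = garch_sigma \<omega> a b s0 e k"
  define d where "d = garch_dev a (s0\<^sup>2 / \<omega>) (\<lambda>i. (e i)\<^sup>2 - 1) k"
  have IH: "s\<^sup>2 = \<omega> * (real k + d)"
    using Suc \<open>0 < \<omega>\<close> by (simp add: s_def d_def field_simps)
  have "(garch_sigma \<omega> a b s0 e (Suc k))\<^sup>2 = \<omega> + a * (s * e k)\<^sup>2 + b * s\<^sup>2"
    using assms by (simp add: Let_def s_def)
  also have "\<dots> = \<omega> + s\<^sup>2 * (1 + a * ((e k)\<^sup>2 - 1))"
    using assms(4) by (simp add: power_mult_distrib algebra_simps flip: distrib_right)
  finally have "(garch_sigma \<omega> a b s0 e (Suc k))\<^sup>2 / \<omega> = (\<omega> + \<omega> * (real k + d) * (1 + a * ((e k)\<^sup>2 - 1))) / \<omega>"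
    by (simp only: IH)
  also have "\<dots> = 1 + (real k + d) * (1 + a * ((e k)\<^sup>2 - 1))"
    using \<open>0 < \<omega>\<close> by (simp add: add_divide_distrib)
  finally show ?case
    unfolding garch_dev.simps d_def[symmetric] by (simp add: algebra_simps del: garch_sigma.simps)
qed simp

lemma past_garch_dev: "past k (\<lambda>e. garch_dev a c e k)"
proof (induction k)
  case (Suc k)
  have "past (Suc k) (\<lambda>e. garch_dev a c e k + a * (real k + garch_dev a c e k) * e k)"
    by (intro past_add past_mult past_const past_coordinate past_Suc[OF Suc]) simp
  then show ?case by simp
qed (simp add: past_const)

lemma past_garch_sum: "past k (\<lambda>e. \<Sum>i<k. garch_dev a c e i * e i)"
proof (induction k)
  case (Suc k)
  have "past (Suc k) (\<lambda>e. (\<Sum>i<k. garch_dev a c e i * e i) + garch_dev a c e k * e k)"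
    by (intro past_add past_mult past_coordinate past_Suc[OF Suc] past_Suc[OF past_garch_dev]) simp
  then show ?case by simp
qed (simp add: past_const)

lemma garch_dev_decomp:
  "garch_dev a c e k = c + a * (\<Sum>i<k. real i * e i) + a * (\<Sum>i<k. garch_dev a c e i * e i)"
  by (induction k) (simp_all add: algebra_simps)

context centered_iid
begin

text \<open>A discrete Gronwall bound. Orthogonality and (x + y)^2 \<le> 2 x^2 + 2 y^2, the origin
  of the 2 in \<open>q\<close>, bound E \<open>D\<^sub>k\<^sub>+\<^sub>1\<^sup>2\<close> by (1 + q)
  E \<open>D\<^sub>k\<^sup>2\<close> + q k^2. The cube absorbs the accumulated squares.\<close>

lemma garch_dev_L2:
  fixes a c :: real
  defines "D \<equiv> \<lambda>k \<omega>. garch_dev a c (\<lambda>i. X i \<omega>) k" and "q \<equiv> 2 * a\<^sup>2 * s2"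
  shows "integrable M (\<lambda>\<omega>. (D k \<omega>)\<^sup>2) \<and> (\<integral>\<omega>. (D k \<omega>)\<^sup>2 \<partial>M) \<le> (1 + q) ^ k * (c\<^sup>2 + q * real k ^ 3)"
proof (induction k)
  case 0
  show ?case by (simp add: D_def prob_space)
next
  case (Suc k)
  have q: "0 \<le> q" using s2_nonneg by (simp add: q_def)
  have [measurable]: "D k \<in> borel_measurable M"
    unfolding D_def by (rule past_process_measurable[OF past_garch_dev])
  let ?v = "\<lambda>e. a * (real k + garch_dev a c e k)"
  have pv: "past k ?v" by (intro past_mult past_add past_const past_garch_dev)
  have v_le: "(a * (real k + D k \<omega>))\<^sup>2 \<le> 2 * a\<^sup>2 * ((real k)\<^sup>2 + (D k \<omega>)\<^sup>2)" for \<omega>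
  proof -
    have "(real k + D k \<omega>)\<^sup>2 \<le> 2 * ((real k)\<^sup>2 + (D k \<omega>)\<^sup>2)"
      using sum_squares_bound[of "real k" "D k \<omega>"] by (simp add: power2_sum)
    then have "a\<^sup>2 * (real k + D k \<omega>)\<^sup>2 \<le> a\<^sup>2 * (2 * ((real k)\<^sup>2 + (D k \<omega>)\<^sup>2))"
      by (intro mult_left_mono) auto
    then show ?thesis by (simp only: power_mult_distrib mult_ac)
  qed
  have dom: "integrable M (\<lambda>\<omega>. 2 * a\<^sup>2 * ((real k)\<^sup>2 + (D k \<omega>)\<^sup>2))"
    using Suc by auto
  have v_sq: "integrable M (\<lambda>\<omega>. (a * (real k + D k \<omega>))\<^sup>2)"
    by (rule Bochner_Integration.integrable_bound[OF dom]) (use v_le in \<open>auto intro: order_trans\<close>)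
  have Ev: "(\<integral>\<omega>. (a * (real k + D k \<omega>))\<^sup>2 \<partial>M) \<le> 2 * a\<^sup>2 * ((real k)\<^sup>2 + (\<integral>\<omega>. (D k \<omega>)\<^sup>2 \<partial>M))"
  proof -
    have "(\<integral>\<omega>. (a * (real k + D k \<omega>))\<^sup>2 \<partial>M) \<le> (\<integral>\<omega>. 2 * a\<^sup>2 * ((real k)\<^sup>2 + (D k \<omega>)\<^sup>2) \<partial>M)"
      by (rule integral_mono[OF v_sq dom]) (use v_le in auto)
    also have "\<dots> = 2 * a\<^sup>2 * ((real k)\<^sup>2 + (\<integral>\<omega>. (D k \<omega>)\<^sup>2 \<partial>M))"
      using Suc by (simp add: prob_space)
    finally show ?thesis .
  qed
  have D_Suc: "D (Suc k) \<omega> = garch_dev a c (\<lambda>i. X i \<omega>) k + ?v (\<lambda>i. X i \<omega>) * X k \<omega>" for \<omega>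
    by (simp add: D_def)
  note step = orthogonal_increment[OF past_garch_dev[of k a c] pv, folded D_Suc]
  have iSuc: "integrable M (\<lambda>\<omega>. (D (Suc k) \<omega>)\<^sup>2)"
    by (rule step) (use Suc v_sq in \<open>auto simp: D_def\<close>)
  have "(\<integral>\<omega>. (D (Suc k) \<omega>)\<^sup>2 \<partial>M) = (\<integral>\<omega>. (D k \<omega>)\<^sup>2 \<partial>M) + s2 * (\<integral>\<omega>. (a * (real k + D k \<omega>))\<^sup>2 \<partial>M)"
    by (subst step) (use Suc v_sq in \<open>auto simp: D_def\<close>)
  also have "\<dots> \<le> (\<integral>\<omega>. (D k \<omega>)\<^sup>2 \<partial>M) + s2 * (2 * a\<^sup>2 * ((real k)\<^sup>2 + (\<integral>\<omega>. (D k \<omega>)\<^sup>2 \<partial>M)))"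
    using Ev s2_nonneg by (intro add_left_mono mult_left_mono)
  also have "\<dots> = (1 + q) * (\<integral>\<omega>. (D k \<omega>)\<^sup>2 \<partial>M) + q * (real k)\<^sup>2"
    by (simp add: q_def algebra_simps)
  \<comment> \<open>The harmless factor \<open>(1 + q) ^ Suc k\<close> is attached to the new term
    so that it can be taken out; then k^3 + k^2 \<le> (k + 1)^3 closes the induction.\<close>
  also have "\<dots> \<le> (1 + q) * ((1 + q) ^ k * (c\<^sup>2 + q * real k ^ 3)) + (1 + q) ^ Suc k * (q * (real k)\<^sup>2)"
  proof (intro add_mono mult_left_mono)
    have "1 * (q * (real k)\<^sup>2) \<le> (1 + q) ^ Suc k * (q * (real k)\<^sup>2)"
      using q by (intro mult_right_mono one_le_power) auto
    then show "q * (real k)\<^sup>2 \<le> (1 + q) ^ Suc k * (q * (real k)\<^sup>2)" by simp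
  qed (use Suc q in auto)
  also have "\<dots> = (1 + q) ^ Suc k * (c\<^sup>2 + q * (real k ^ 3 + (real k)\<^sup>2))"
    by (simp add: algebra_simps)
  also have "\<dots> \<le> (1 + q) ^ Suc k * (c\<^sup>2 + q * real (Suc k) ^ 3)"
    using q by (intro mult_left_mono add_left_mono) (auto simp: power2_eq_square power3_eq_cube algebra_simps)
  finally show ?case using iSuc by blast
qed

text \<open>The terms are orthogonal, so their second moments add. Replacing (1 + q)^k by exp (n q)
  makes the bound for a single term uniform up to \<open>n\<close>.\<close>

lemma garch_remainder_L2:
  fixes a c :: real
  defines "R \<equiv> \<lambda>k \<omega>. \<Sum>i<k. garch_dev a c (\<lambda>i. X i \<omega>) i * X i \<omega>" and "q \<equiv> 2 * a\<^sup>2 * s2"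
  assumes "k \<le> n"
  shows "integrable M (\<lambda>\<omega>. (R k \<omega>)\<^sup>2) \<and> (\<integral>\<omega>. (R k \<omega>)\<^sup>2 \<partial>M) \<le> real k * (s2 * exp (real n * q) * (c\<^sup>2 + q * real n ^ 3))"
  using \<open>k \<le> n\<close>
proof (induction k)
  case 0
  show ?case by (simp add: R_def)
next
  case (Suc k)
  have q: "0 \<le> q" using s2_nonneg by (simp add: q_def)
  let ?u = "\<lambda>e. \<Sum>i<k. garch_dev a c e i * e i"
  have R_Suc: "R (Suc k) \<omega> = ?u (\<lambda>i. X i \<omega>) + garch_dev a c (\<lambda>i. X i \<omega>) k * X k \<omega>" for \<omega>
    by (simp add: R_def)
  note D = garch_dev_L2[of a c k, folded q_def]
  note step = orthogonal_increment[OF past_garch_sum[of k a c] past_garch_dev[of k a c], folded R_Suc]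
  have iSuc: "integrable M (\<lambda>\<omega>. (R (Suc k) \<omega>)\<^sup>2)"
    by (rule step) (use Suc D in \<open>auto simp: R_def\<close>)
  have "(\<integral>\<omega>. (R (Suc k) \<omega>)\<^sup>2 \<partial>M) = (\<integral>\<omega>. (R k \<omega>)\<^sup>2 \<partial>M) + s2 * (\<integral>\<omega>. (garch_dev a c (\<lambda>i. X i \<omega>) k)\<^sup>2 \<partial>M)"
    by (subst step) (use Suc D in \<open>auto simp: R_def\<close>)
  also have "\<dots> \<le> real k * (s2 * exp (real n * q) * (c\<^sup>2 + q * real n ^ 3)) + s2 * (exp (real n * q) * (c\<^sup>2 + q * real n ^ 3))"
  proof (intro add_mono mult_left_mono s2_nonneg)
    have "(1 + q) ^ k \<le> exp q ^ k"
      using q by (intro power_mono) auto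
    also have "\<dots> = exp (real k * q)" by (simp add: exp_of_nat_mult)
    also have "\<dots> \<le> exp (real n * q)" using Suc q by (auto intro: mult_right_mono)
    finally have "(1 + q) ^ k * (c\<^sup>2 + q * real k ^ 3) \<le> exp (real n * q) * (c\<^sup>2 + q * real n ^ 3)"
      using q Suc by (intro mult_mono add_left_mono mult_left_mono power_mono) auto
    with D show "(\<integral>\<omega>. (garch_dev a c (\<lambda>i. X i \<omega>) k)\<^sup>2 \<partial>M) \<le> exp (real n * q) * (c\<^sup>2 + q * real n ^ 3)"
      by linarith
  qed (use Suc in auto)
  finally show ?case using iSuc by (simp add: algebra_simps)
qed

text \<open>Provides the uniform second-moment bound for the main term that the perturbation
  argument requires.\<close>

lemma weighted_sum_L2:
  "integrable M (\<lambda>\<omega>. (\<Sum>i<k. w i * X i \<omega>)\<^sup>2) \<and>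
    (\<integral>\<omega>. (\<Sum>i<k. w i * X i \<omega>)\<^sup>2 \<partial>M) = s2 * (\<Sum>i<k. (w i)\<^sup>2)"
proof (induction k)
  case (Suc k)
  have past_sum: "past k (\<lambda>e. \<Sum>i<k. w i * e i)"
    by (auto simp: past_def)
  have "integrable M (\<lambda>\<omega>. (w k)\<^sup>2)" by simp
  note step = orthogonal_increment[OF past_sum past_const _ this]
  show ?case
    using step Suc by (simp add: prob_space algebra_simps)
qed simp

end

section \<open>Limits of the main term and of the remainder\<close>

lemma tendsto_floor_fraction:
  fixes t :: real
  assumes "0 \<le> t"
  shows "(\<lambda>n. real (nat \<lfloor>real n * t\<rfloor>) / real n) \<longlonglongrightarrow> t"
proof (rule real_tendsto_sandwich[where f="\<lambda>n. t - 1 / real n" and h="\<lambda>_. t"])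
  have floor: "real n * t - 1 \<le> real (nat \<lfloor>real n * t\<rfloor>)" "real (nat \<lfloor>real n * t\<rfloor>) \<le> real n * t" for n
    using assms by (auto simp: of_nat_nat)
  show "\<forall>\<^sub>F n in sequentially. t - 1 / real n \<le> real (nat \<lfloor>real n * t\<rfloor>) / real n"
    using eventually_gt_at_top[of 0]
  proof eventually_elim
    case (elim n)
    then have "t - 1 / real n = (real n * t - 1) / real n" by (simp add: field_simps)
    then show ?case using floor(1)[of n] elim by (simp add: divide_right_mono)
  qed
  show "\<forall>\<^sub>F n in sequentially. real (nat \<lfloor>real n * t\<rfloor>) / real n \<le> t"
    using eventually_gt_at_top[of 0]
  proof eventually_elim
    case (elim n)
    then show ?case using floor(2)[of n] by (simp add: field_simps)
  qed
  have "(\<lambda>n. t - 1 / real n) \<longlonglongrightarrow> t - 0" by (intro tendsto_intros lim_1_over_n)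
  then show "(\<lambda>n. t - 1 / real n) \<longlonglongrightarrow> t" by simp
qed simp

lemma powr_three_halves_square: "(real n powr (3 / 2))\<^sup>2 = real n ^ 3"
proof (cases "n = 0")
  case False
  then have "(real n powr (3 / 2))\<^sup>2 = real n powr (3 / 2 * 2)"
    by (subst powr_powr[symmetric]) (simp add: powr_numeral)
  then show ?thesis using False by (simp add: powr_numeral)
qed simp

text \<open>The last summand is (k - 1)^2, so this is the usual formula with k - 1 in place of k;
  real subtraction covers k = 0.\<close>

lemma sum_squares_real: "(\<Sum>i<k. (real i)\<^sup>2) = (real k - 1) * real k * (2 * real k - 1) / 6"
  by (induction k) (auto simp: field_simps power2_eq_square)

text \<open>In terms of \<kappa> = [nt] / n, the closed form becomes (\<kappa> - 1/n) \<kappa> (2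
  \<kappa> - 1/n) / 6, whose limit is t * t * 2 t / 6.\<close>

lemma sum_weights_tendsto:
  fixes t :: real
  assumes "0 \<le> t"
  shows "(\<lambda>n. \<Sum>i<nat \<lfloor>real n * t\<rfloor>. (real i / real n powr (3 / 2))\<^sup>2) \<longlonglongrightarrow> t ^ 3 / 3"
proof -
  define \<kappa> where "\<kappa> n = real (nat \<lfloor>real n * t\<rfloor>) / real n" for n
  have \<kappa>: "\<kappa> \<longlonglongrightarrow> t" unfolding \<kappa>_def by (rule tendsto_floor_fraction[OF assms])
  have "(\<lambda>n. (\<kappa> n - 1 / real n) * \<kappa> n * (2 * \<kappa> n - 1 / real n) / 6) \<longlonglongrightarrow> (t - 0) * t * (2 * t - 0) / 6"
    by (intro tendsto_intros \<kappa> lim_1_over_n) auto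
  moreover have "\<forall>\<^sub>F n in sequentially. (\<kappa> n - 1 / real n) * \<kappa> n * (2 * \<kappa> n - 1 / real n) / 6 =
      (\<Sum>i<nat \<lfloor>real n * t\<rfloor>. (real i / real n powr (3 / 2))\<^sup>2)"
    using eventually_gt_at_top[of 0]
  proof eventually_elim
    case (elim n)
    define k where "k = nat \<lfloor>real n * t\<rfloor>"
    have "(\<Sum>i<k. (real i / real n powr (3 / 2))\<^sup>2) = (\<Sum>i<k. (real i)\<^sup>2) / real n ^ 3"
      by (simp add: power_divide powr_three_halves_square sum_divide_distrib)
    then show ?case using elim
      by (simp add: \<kappa>_def sum_squares_real flip: k_def) (simp add: field_simps power3_eq_cube)
  qed
  ultimately have "(\<lambda>n. \<Sum>i<nat \<lfloor>real n * t\<rfloor>. (real i / real n powr (3 / 2))\<^sup>2) \<longlonglongrightarrow> (t - 0) * t * (2 * t - 0) / 6"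
    by (rule Lim_transform_eventually)
  then show ?thesis by (simp add: power3_eq_cube mult.assoc)
qed

lemma (in prob_space) indep_vars_block_sums:
  fixes X :: "nat \<Rightarrow> 'a \<Rightarrow> real" and K :: "'n::{finite, linorder} \<Rightarrow> nat"
  assumes indep: "indep_vars (\<lambda>_. borel) X UNIV"
  shows "indep_vars (\<lambda>_. borel) (\<lambda>l x. \<Sum>i\<in>block K l. w i * X i x) UNIV"
proof -
  have "indep_vars (\<lambda>l. PiM (block K l) (\<lambda>_. borel)) (\<lambda>l x. restrict (\<lambda>i. X i x) (block K l)) UNIV"
    by (rule indep_vars_restrict[OF indep]) (auto simp: disjoint_block)
  then have "indep_vars (\<lambda>_. borel) (\<lambda>l x. \<Sum>i\<in>block K l. w i * restrict (\<lambda>i. X i x) (block K l) i) UNIV"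
    by (rule indep_vars_compose2[where Y="\<lambda>l e. \<Sum>i\<in>block K l. w i * e i"]) measurable
  then show ?thesis by simp
qed

lemma (in prob_space) weighted_partial_sums_limit:
  fixes X :: "nat \<Rightarrow> 'a \<Rightarrow> real" and t :: "'n::{finite, linorder} \<Rightarrow> real"
  assumes indep: "indep_vars (\<lambda>_. borel) X UNIV"
    and distr_X: "\<And>i. distr M borel (X i) = \<mu>"
    and mean: "(\<integral>x. x \<partial>\<mu>) = 0"
    and sq: "integrable \<mu> (\<lambda>x. x\<^sup>2)" and var: "(\<integral>x. x\<^sup>2 \<partial>\<mu>) = 1"
    and t: "mono t" "\<And>m. 0 \<le> t m" "\<And>m. t m \<le> 1"
  shows "\<exists>v. (\<forall>l. 0 \<le> v l) \<and> (\<forall>m. (\<Sum>l\<in>{..m}. v l) = t m ^ 3 / 3) \<and>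
    (\<forall>f :: real ^ 'n::{finite, linorder} \<Rightarrow> real. continuous_on UNIV f \<longrightarrow> bounded (range f) \<longrightarrow>
      (\<lambda>n. \<integral>x. f (\<chi> m. \<Sum>i<nat \<lfloor>real n * t m\<rfloor>. real i / real n powr (3 / 2) * X i x) \<partial>M)
        \<longlonglongrightarrow> (\<integral>z. f z \<partial>partial_sums_law v))"
proof -
  have [measurable]: "X i \<in> borel_measurable M" for i
    using indep by (auto simp: indep_vars_def2)
  define K where "K n m = nat \<lfloor>real n * t m\<rfloor>" for n m
  define w where "w n i = real i / real n powr (3 / 2)" for n i
  have mono_K: "mono (K n)" for n
    using t(1) by (auto simp: K_def mono_def intro!: nat_mono floor_mono mult_left_mono)
  have K_le: "K n m \<le> n" for n m
  proof -
    have "real n * t m \<le> real n" using t(3)[of m] mult_left_mono[of "t m" 1 "real n"] by simp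
    then show ?thesis unfolding K_def by linarith
  qed
  define S where "S n l x = (\<Sum>i\<in>block (K n) l. w n i * X i x)" for n l x
  have [measurable]: "S n l \<in> borel_measurable M" for n l unfolding S_def by measurable
  have "(\<lambda>n. \<Sum>l\<in>{..m}. \<Sum>i\<in>block (K n) l. (w n i)\<^sup>2) \<longlonglongrightarrow> t m ^ 3 / 3" for m
    unfolding sum_blocks[OF mono_K] K_def w_def by (rule sum_weights_tendsto[OF t(2)])
  from tendsto_from_partial_sums[OF this]
  obtain v where v: "\<And>l. (\<lambda>n. \<Sum>i\<in>block (K n) l. (w n i)\<^sup>2) \<longlonglongrightarrow> v l"
    and v_sum: "\<And>m. (\<Sum>l\<in>{..m}. v l) = t m ^ 3 / 3"
    by blast
  have v_nonneg: "0 \<le> v l" for l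
    by (rule LIMSEQ_le_const[OF v]) (simp add: sum_nonneg)
  have clt: "weak_conv_m (\<lambda>n. distr M borel (S n l)) (centered_normal (v l))" for l
    unfolding S_def
  \<comment> \<open>Every index in a block is below \<open>n\<close>, as t \<le> 1, so each weight
    is at most n / n^(3/2). No single summand survives in the limit.\<close>
  proof (rule weighted_clt[OF indep distr_X mean sq var, where b="\<lambda>n. real n powr (- 1 / 2)"])
    show "(\<lambda>n. real n powr (- 1 / 2)) \<longlonglongrightarrow> 0"
      by (rule tendsto_neg_powr) (auto simp: filterlim_real_sequentially)
    fix n i assume "i \<in> block (K n) l"
    then have "i < n" using block_less[of i "K n" l] K_le[of n l] by simp
    then have "real i / real n powr (3 / 2) \<le> real n / real n powr (3 / 2)"
      by (intro divide_right_mono) auto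
    also have "\<dots> = real n powr (1 - 3 / 2)"
      using \<open>i < n\<close> by (subst powr_diff) simp
    finally show "\<bar>w n i\<bar> \<le> real n powr (- 1 / 2)" by (simp add: w_def)
  qed (use v v_nonneg in auto)
  \<comment> \<open>Independence of the block sums in the form needed for
    \<open>weak_conv_PiM\<close>: their joint law is a product measure for every
    \<open>n\<close>.\<close>
  have law: "distr M (PiM UNIV (\<lambda>_. borel)) (\<lambda>x l. S n l x) = PiM UNIV (\<lambda>l. distr M borel (S n l))" for n
  proof -
    have "indep_vars (\<lambda>_. borel) (S n) UNIV"
      unfolding S_def by (rule indep_vars_block_sums[OF indep])
    then show ?thesis
      by (subst (asm) indep_vars_iff_distr_eq_PiM') (auto simp: restrict_UNIV)
  qed
  have S_meas: "(\<lambda>x l. S n l x) \<in> measurable M (PiM UNIV (\<lambda>_. borel))" for n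
    by (rule measurable_PiM_single') auto
  have vec: "(\<chi> m. \<Sum>i<nat \<lfloor>real n * t m\<rfloor>. real i / real n powr (3 / 2) * X i x) = partial_sums (\<lambda>l. S n l x)" for n x
    unfolding partial_sums_def S_def sum_blocks[OF mono_K] by (simp add: K_def w_def)
  have "(\<lambda>n. \<integral>x. f (partial_sums (\<lambda>l. S n l x)) \<partial>M) \<longlonglongrightarrow> (\<integral>z. f z \<partial>partial_sums_law v)"
    if cont: "continuous_on UNIV f" and bdd: "bounded (range f)" for f :: "real ^ 'n::{finite, linorder} \<Rightarrow> real"
  proof -
    have f: "f \<in> borel_measurable borel" using cont by (rule borel_measurable_continuous_onI)
    have f': "(\<lambda>z. f (partial_sums z)) \<in> borel_measurable (PiM UNIV (\<lambda>_. borel))"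
      by (rule measurable_compose[OF partial_sums_measurable f])
    obtain B where B: "\<And>z. \<bar>f z\<bar> \<le> B" using bdd by (auto simp: bounded_iff)
    have "(\<lambda>n. \<integral>z. f (partial_sums z) \<partial>PiM UNIV (\<lambda>l. distr M borel (S n l)))
        \<longlonglongrightarrow> (\<integral>z. f (partial_sums z) \<partial>normal_product v)"
    proof (rule weak_conv_PiM[OF _ _ clt f'])
      show "real_distribution (distr M borel (S n l))" for n l
        by (rule real_distribution_distr) simp
      show "(\<lambda>n. f (partial_sums (z n))) \<longlonglongrightarrow> f (partial_sums z')"
        if "\<And>l. (\<lambda>n. z n l) \<longlonglongrightarrow> z' l" for z z'
        by (rule continuous_on_tendsto_compose[OF cont tendsto_partial_sums]) (use that in auto)
    qed (use B in auto)
    moreover have "(\<integral>z. f (partial_sums z) \<partial>PiM UNIV (\<lambda>l. distr M borel (S n l))) = (\<integral>x. f (partial_sums (\<lambda>l. S n l x)) \<partial>M)" for n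
      unfolding law[symmetric] by (rule integral_distr[OF S_meas f'])
    moreover have "(\<integral>z. f (partial_sums z) \<partial>normal_product v) = (\<integral>z. f z \<partial>partial_sums_law v)"
      unfolding partial_sums_law_def
      by (rule integral_distr[symmetric, OF _ f]) (simp add: measurable_normal_product partial_sums_measurable)
    ultimately show ?thesis by simp
  qed
  then show ?thesis
    using v_nonneg v_sum unfolding vec by blast
qed

context centered_iid
begin

text \<open>The inequality (x + y)^2 \<le> 2 x^2 + 2 y^2 separates the constant from the sum. The
  bound is arranged in the factors 1/n, 1/(n a) and u = 2 s2 (n^(1/2) a)^2, which tend to 0 when
  \<open>a\<close> is \<alpha> at \<open>n\<close>.\<close>

lemma normalized_remainder_L2:
  fixes a c :: real and n k :: nat
  defines "r \<equiv> \<lambda>\<omega>. 1 / (real n powr (3 / 2) * a) * (1 / sqrt s2) * (c + a * (\<Sum>i<k. garch_dev a c (\<lambda>i. X i \<omega>) i * X i \<omega>))"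
    and "u \<equiv> real n * (2 * a\<^sup>2 * s2)"
  assumes "0 < s2" "0 < a" "0 < n" "k \<le> n"
  shows "integrable M (\<lambda>\<omega>. (r \<omega>)\<^sup>2)"
    and "(\<integral>\<omega>. (r \<omega>)\<^sup>2 \<partial>M) \<le> 2 * c\<^sup>2 / s2 * (1 / real n) * (1 / (real n * a))\<^sup>2 + 2 * exp u * (c\<^sup>2 * (1 / real n)\<^sup>2 + u)"
proof -
  define R where "R = (\<lambda>\<omega>. \<Sum>i<k. garch_dev a c (\<lambda>i. X i \<omega>) i * X i \<omega>)"
  have [measurable]: "(\<lambda>\<omega>. garch_dev a c (\<lambda>i. X i \<omega>) i) \<in> borel_measurable M" for i
    by (rule past_process_measurable[OF past_garch_dev])
  have [measurable]: "R \<in> borel_measurable M" unfolding R_def by measurable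
  have R_sq: "integrable M (\<lambda>\<omega>. (R \<omega>)\<^sup>2)"
    and R_le: "(\<integral>\<omega>. (R \<omega>)\<^sup>2 \<partial>M) \<le> real k * (s2 * exp u * (c\<^sup>2 + 2 * a\<^sup>2 * s2 * real n ^ 3))"
    using garch_remainder_L2[OF \<open>k \<le> n\<close>, of a c] by (auto simp: R_def u_def)
  have r_sq: "(r \<omega>)\<^sup>2 = 1 / (real n ^ 3 * a\<^sup>2 * s2) * (c + a * R \<omega>)\<^sup>2" for \<omega>
    using \<open>0 < s2\<close> by (simp add: r_def R_def power_mult_distrib power_divide powr_three_halves_square)
  have r_le: "(r \<omega>)\<^sup>2 \<le> 2 * c\<^sup>2 / (real n ^ 3 * a\<^sup>2 * s2) + 2 / (real n ^ 3 * s2) * (R \<omega>)\<^sup>2" for \<omega>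
  proof -
    have "(c + a * R \<omega>)\<^sup>2 \<le> 2 * c\<^sup>2 + 2 * (a * R \<omega>)\<^sup>2"
      using sum_squares_bound[of c "a * R \<omega>"] by (simp add: power2_sum)
    then have "(r \<omega>)\<^sup>2 \<le> 1 / (real n ^ 3 * a\<^sup>2 * s2) * (2 * c\<^sup>2 + 2 * (a * R \<omega>)\<^sup>2)"
      unfolding r_sq using \<open>0 < s2\<close> by (intro mult_left_mono) auto
    also have "\<dots> = 2 * c\<^sup>2 / (real n ^ 3 * a\<^sup>2 * s2) + 2 / (real n ^ 3 * s2) * (R \<omega>)\<^sup>2"
      using assms by (simp add: power_mult_distrib add_divide_distrib)
    finally show ?thesis .
  qed
  have dom: "integrable M (\<lambda>\<omega>. 2 * c\<^sup>2 / (real n ^ 3 * a\<^sup>2 * s2) + 2 / (real n ^ 3 * s2) * (R \<omega>)\<^sup>2)"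
    using R_sq by simp
  have [measurable]: "r \<in> borel_measurable M" unfolding r_def by measurable
  show r_int: "integrable M (\<lambda>\<omega>. (r \<omega>)\<^sup>2)"
  proof (rule Bochner_Integration.integrable_bound[OF dom])
    show "AE \<omega> in M. norm ((r \<omega>)\<^sup>2) \<le> norm (2 * c\<^sup>2 / (real n ^ 3 * a\<^sup>2 * s2) + 2 / (real n ^ 3 * s2) * (R \<omega>)\<^sup>2)"
      using r_le by (intro AE_I2) (metis abs_ge_self norm_power order_trans power2_abs real_norm_def)
  qed simp
  have "(\<integral>\<omega>. (r \<omega>)\<^sup>2 \<partial>M) \<le> (\<integral>\<omega>. 2 * c\<^sup>2 / (real n ^ 3 * a\<^sup>2 * s2) + 2 / (real n ^ 3 * s2) * (R \<omega>)\<^sup>2 \<partial>M)"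
    by (rule integral_mono[OF r_int dom r_le])
  also have "\<dots> = 2 * c\<^sup>2 / (real n ^ 3 * a\<^sup>2 * s2) + 2 / (real n ^ 3 * s2) * (\<integral>\<omega>. (R \<omega>)\<^sup>2 \<partial>M)"
    using R_sq by (simp add: prob_space)
  also have "\<dots> \<le> 2 * c\<^sup>2 / (real n ^ 3 * a\<^sup>2 * s2) +
      2 / (real n ^ 3 * s2) * (real n * (s2 * exp u * (c\<^sup>2 + 2 * a\<^sup>2 * s2 * real n ^ 3)))"
  proof (intro add_left_mono mult_left_mono)
    have "real k * (s2 * exp u * (c\<^sup>2 + 2 * a\<^sup>2 * s2 * real n ^ 3)) \<le> real n * (s2 * exp u * (c\<^sup>2 + 2 * a\<^sup>2 * s2 * real n ^ 3))"
      using assms by (intro mult_right_mono) auto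
    with R_le show "(\<integral>\<omega>. (R \<omega>)\<^sup>2 \<partial>M) \<le> real n * (s2 * exp u * (c\<^sup>2 + 2 * a\<^sup>2 * s2 * real n ^ 3))"
      by linarith
  qed (use assms in auto)
  also have "\<dots> = 2 * c\<^sup>2 / s2 * (1 / real n) * (1 / (real n * a))\<^sup>2 + 2 * exp u * (c\<^sup>2 * (1 / real n)\<^sup>2 + u)"
  proof -
    have "2 * c\<^sup>2 / (real n ^ 3 * a\<^sup>2 * s2) = 2 * c\<^sup>2 / s2 * (1 / real n) * (1 / (real n * a))\<^sup>2"
      using assms(3-5) by (simp add: power2_eq_square power3_eq_cube)
    moreover have "2 / (real n ^ 3 * s2) * (real n * (s2 * exp u * (c\<^sup>2 + 2 * a\<^sup>2 * s2 * real n ^ 3))) = 2 * exp u * (c\<^sup>2 * (1 / real n)\<^sup>2 + u)"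
      unfolding u_def using assms(3-5) by (simp add: field_simps power2_eq_square power3_eq_cube)
    ultimately show ?thesis by simp
  qed
  finally show "(\<integral>\<omega>. (r \<omega>)\<^sup>2 \<partial>M) \<le> 2 * c\<^sup>2 / s2 * (1 / real n) * (1 / (real n * a))\<^sup>2 + 2 * exp u * (c\<^sup>2 * (1 / real n)\<^sup>2 + u)" .
qed

end

section \<open>Moments of the noise and the limit theorem\<close>

lemma (in prob_space) integrable_fourth_power:
  fixes f :: "'a \<Rightarrow> real"
  assumes [measurable]: "f \<in> borel_measurable M"
    and "0 < \<delta>" and int: "integrable M (\<lambda>x. \<bar>f x\<bar> powr (4 + \<delta>))"
  shows "integrable M (\<lambda>x. f x ^ 4)"
proof (rule Bochner_Integration.integrable_bound[where f="\<lambda>x. 1 + \<bar>f x\<bar> powr (4 + \<delta>)"])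
  show "AE x in M. norm (f x ^ 4) \<le> norm (1 + \<bar>f x\<bar> powr (4 + \<delta>))"
  proof (intro AE_I2)
    fix x
    have "\<bar>f x\<bar> ^ 4 \<le> 1 + \<bar>f x\<bar> powr (4 + \<delta>)"
    proof (cases "\<bar>f x\<bar> \<le> 1")
      case True
      then have "\<bar>f x\<bar> ^ 4 \<le> 1" by (intro power_le_one) auto
      then show ?thesis by (smt (verit) powr_ge_zero)
    next
      case False
      then have "\<bar>f x\<bar> powr 4 \<le> \<bar>f x\<bar> powr (4 + \<delta>)"
        using \<open>0 < \<delta>\<close> by (intro powr_mono) auto
      then show ?thesis using False by (simp add: powr_numeral)
    qed
    then show "norm (f x ^ 4) \<le> norm (1 + \<bar>f x\<bar> powr (4 + \<delta>))"
      by (simp add: power_abs)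
  qed
qed (use int in auto)

lemma (in prob_space) indep_vars_same_distr_compose:
  fixes X :: "nat \<Rightarrow> 'a \<Rightarrow> real" and g :: "real \<Rightarrow> real"
  assumes indep: "indep_vars (\<lambda>_. borel) X UNIV"
    and same: "\<And>k. distr M borel (X k) = distr M borel (X 0)"
    and [measurable]: "g \<in> borel_measurable borel"
  shows "indep_vars (\<lambda>_. borel) (\<lambda>k x. g (X k x)) UNIV"
    and "distr M borel (\<lambda>x. g (X k x)) = distr M borel (\<lambda>x. g (X 0 x))"
proof -
  have [measurable]: "X k \<in> borel_measurable M" for k
    using indep by (auto simp: indep_vars_def2)
  show "indep_vars (\<lambda>_. borel) (\<lambda>k x. g (X k x)) UNIV"
    by (rule indep_vars_compose2[OF indep]) simp
  have "distr M borel (\<lambda>x. g (X k x)) = distr (distr M borel (X k)) borel g" for k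
    by (subst distr_distr) (auto simp: comp_def)
  then show "distr M borel (\<lambda>x. g (X k x)) = distr M borel (\<lambda>x. g (X 0 x))"
    by (simp add: same[of k])
qed

lemma norm_vec_sq: "(norm (x :: real ^ 'n))\<^sup>2 = (\<Sum>m\<in>UNIV. (x $ m)\<^sup>2)"
  by (simp add: norm_vec_def L2_set_def sum_nonneg)

theorem theorem2p3:
  fixes M :: "'a measure"
    and \<epsilon> :: "nat \<Rightarrow> 'a \<Rightarrow> real"
    and \<omega> \<sigma>0 \<delta> :: real
    and \<alpha> \<beta> :: "nat \<Rightarrow> real"
    and t :: "'n::{finite, linorder} \<Rightarrow> real"
  assumes "prob_space M"
    and "prob_space.indep_vars M (\<lambda>_. borel) \<epsilon> UNIV"
    and "\<And>k. distr M borel (\<epsilon> k) = distr M borel (\<epsilon> 0)"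
    and "\<not> (\<exists>c. AE x in M. (\<epsilon> 0 x)\<^sup>2 = c)"
    and "0 < \<omega>"
    and "\<And>n. n \<ge> 1 \<Longrightarrow> 0 \<le> \<alpha> n"
    and "\<And>n. n \<ge> 1 \<Longrightarrow> 0 \<le> \<beta> n"
    and "\<alpha> \<longlonglongrightarrow> 0"
    and "\<beta> \<longlonglongrightarrow> 1"
    and "\<And>n. n \<ge> 1 \<Longrightarrow> \<alpha> n + \<beta> n - 1 = 0"
    and "integrable M (\<lambda>x. (\<epsilon> 0 x)\<^sup>2)"
    and "(\<integral>x. (\<epsilon> 0 x)\<^sup>2 \<partial>M) = 1"
    and "0 < \<delta>"
    and "integrable M (\<lambda>x. \<bar>\<epsilon> 0 x\<bar> powr (4 + \<delta>))"
    and "(\<lambda>n. sqrt (real n) * \<alpha> n) \<longlonglongrightarrow> 0"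
    and "filterlim (\<lambda>n. real n * \<alpha> n) at_top sequentially"
    and "strict_mono t"
    and "\<And>m. 0 < t m"
    and "\<And>m. t m \<le> 1"
  shows "\<exists>\<zeta> :: (real ^ 'n::{finite, linorder}) measure.
           multivariate_gaussian \<zeta> \<and>
           (\<forall>i. (\<integral>z. z $ i \<partial>\<zeta>) = 0) \<and>
           (\<forall>i j. (\<integral>z. z $ i * z $ j \<partial>\<zeta>) = 1 / 3 * (min (t i) (t j)) ^ 3) \<and>
           weakly_converges
             (\<lambda>n. distr M borel (\<lambda>x. \<chi> m.
                1 / (real n powr (3 / 2) * \<alpha> n) *
                (1 / sqrt (\<integral>u. ((\<epsilon> 0 u)\<^sup>2 - 1)\<^sup>2 \<partial>M)) *
                ((garch_sigma \<omega> (\<alpha> n) (\<beta> n) \<sigma>0 (\<lambda>k. \<epsilon> k x) (nat \<lfloor>real n * t m\<rfloor>))\<^sup>2 / \<omega>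
                   - real_of_int \<lfloor>real n * t m\<rfloor>)))
             \<zeta>"
proof -
  interpret prob_space M by fact
  have \<epsilon>_meas [measurable]: "\<epsilon> k \<in> borel_measurable M" for k
    using assms(2) by (auto simp: indep_vars_def2)
  define \<xi> where "\<xi> k x = (\<epsilon> k x)\<^sup>2 - 1" for k x
  have [measurable]: "\<xi> k \<in> borel_measurable M" for k unfolding \<xi>_def by measurable
  have \<xi>_indep: "indep_vars (\<lambda>_. borel) \<xi> UNIV"
    and \<xi>_distr: "distr M borel (\<xi> k) = distr M borel (\<xi> 0)" for k
    unfolding \<xi>_def using indep_vars_same_distr_compose[OF assms(2,3), of "\<lambda>y. y\<^sup>2 - 1"] by auto
  define s2 where "s2 = (\<integral>x. (\<xi> 0 x)\<^sup>2 \<partial>M)"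
  have \<xi>0_sq: "integrable M (\<lambda>x. (\<xi> 0 x)\<^sup>2)"
  proof -
    have "integrable M (\<lambda>x. \<epsilon> 0 x ^ 4 - 2 * (\<epsilon> 0 x)\<^sup>2 + 1)"
      using integrable_fourth_power[OF \<epsilon>_meas assms(13,14)] assms(11) by auto
    moreover have "(\<lambda>x. (\<xi> 0 x)\<^sup>2) = (\<lambda>x. \<epsilon> 0 x ^ 4 - 2 * (\<epsilon> 0 x)\<^sup>2 + 1)"
      by (simp add: \<xi>_def fun_eq_iff power2_eq_square power4_eq_xxxx algebra_simps)
    ultimately show ?thesis by simp
  qed
  have \<xi>0_mean: "(\<integral>x. \<xi> 0 x \<partial>M) = 0"
    using assms(11,12) by (simp add: \<xi>_def prob_space)
  have s2_pos: "0 < s2"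
  proof -
    \<comment> \<open>Variance zero would make the squared innovation almost surely equal to 1,
      contradicting nondegeneracy.\<close>
    have "s2 \<noteq> 0"
    proof
      assume "s2 = 0"
      then have "AE x in M. (\<xi> 0 x)\<^sup>2 = 0"
        using integral_nonneg_eq_0_iff_AE[OF \<xi>0_sq] by (auto simp: s2_def)
      then have "AE x in M. (\<epsilon> 0 x)\<^sup>2 = 1" by eventually_elim (simp add: \<xi>_def)
      then show False using assms(4) by blast
    qed
    moreover have "0 \<le> s2" by (simp add: s2_def)
    ultimately show ?thesis by simp
  qed
  have transfer: "(\<integral>x. g (\<xi> k x) \<partial>M) = (\<integral>x. g (\<xi> 0 x) \<partial>M)"
    "integrable M (\<lambda>x. g (\<xi> k x)) \<longleftrightarrow> integrable M (\<lambda>x. g (\<xi> 0 x))"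
    if [measurable]: "g \<in> borel_measurable borel" for g :: "real \<Rightarrow> real" and k
    using integral_distr[of "\<xi> k" M borel g] integral_distr[of "\<xi> 0" M borel g]
      integrable_distr_eq[of "\<xi> k" M borel g] integrable_distr_eq[of "\<xi> 0" M borel g] \<xi>_distr[of k] by simp_all
  interpret centered_iid M \<xi> s2
  proof
    show "(\<integral>x. \<xi> k x \<partial>M) = 0" for k using transfer(1)[of "\<lambda>y. y" k] \<xi>0_mean by simp
    show "integrable M (\<lambda>x. (\<xi> k x)\<^sup>2)" for k using transfer(2)[of "\<lambda>y. y\<^sup>2" k] \<xi>0_sq by simp
    show "(\<integral>x. (\<xi> k x)\<^sup>2 \<partial>M) = s2" for k using transfer(1)[of "\<lambda>y. y\<^sup>2" k] by (simp add: s2_def)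
  qed (rule \<xi>_indep)

  define \<eta> where "\<eta> k x = \<xi> k x / sqrt s2" for k x
  have [measurable]: "\<eta> k \<in> borel_measurable M" for k unfolding \<eta>_def by measurable
  have \<eta>_indep: "indep_vars (\<lambda>_. borel) \<eta> UNIV"
    and \<eta>_distr: "distr M borel (\<eta> k) = distr M borel (\<eta> 0)" for k
    unfolding \<eta>_def using indep_vars_same_distr_compose[OF \<xi>_indep \<xi>_distr, of "\<lambda>y. y / sqrt s2"] by auto
  have \<eta>_mean: "(\<integral>y. y \<partial>distr M borel (\<eta> 0)) = 0"
  proof -
    have "(\<integral>x. \<eta> 0 x \<partial>M) = 0" unfolding \<eta>_def by (simp add: \<xi>0_mean)
    then show ?thesis by (subst integral_distr) auto
  qed
  have \<eta>_sq: "integrable (distr M borel (\<eta> 0)) (\<lambda>y. y\<^sup>2)"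
    by (subst integrable_distr_eq) (auto simp: \<eta>_def power_divide \<xi>0_sq)
  have \<eta>_var: "(\<integral>y. y\<^sup>2 \<partial>distr M borel (\<eta> 0)) = 1"
    using s2_pos by (subst integral_distr) (auto simp: \<eta>_def power_divide s2_def[symmetric])
  have mono_t: "mono t" using assms(17) by (rule strict_mono_mono)
  have t_nonneg: "0 \<le> t m" for m using assms(18)[of m] by simp
  obtain v where v: "\<And>l. 0 \<le> v l" and v_sum: "\<And>m. (\<Sum>l\<in>{..m}. v l) = t m ^ 3 / 3"
    and v_lim: "\<And>f :: real ^ 'n::{finite, linorder} \<Rightarrow> real. continuous_on UNIV f \<Longrightarrow> bounded (range f) \<Longrightarrow>
      (\<lambda>n. \<integral>x. f (\<chi> m. \<Sum>i<nat \<lfloor>real n * t m\<rfloor>. real i / real n powr (3 / 2) * \<eta> i x) \<partial>M)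
        \<longlonglongrightarrow> (\<integral>z. f z \<partial>partial_sums_law v)"
    using weighted_partial_sums_limit[OF \<eta>_indep \<eta>_distr \<eta>_mean \<eta>_sq \<eta>_var mono_t t_nonneg assms(19)] by blast

  \<comment> \<open>Main term, remainder and their second moments\<close>
  define c where "c = \<sigma>0\<^sup>2 / \<omega>"
  define k where "k n m = nat \<lfloor>real n * t m\<rfloor>" for n m
  have k_le: "k n m \<le> n" for n m
  proof -
    have "real n * t m \<le> real n" using assms(19)[of m] mult_left_mono[of "t m" 1 "real n"] by simp
    then show ?thesis unfolding k_def by linarith
  qed
  define Q where "Q n x = (\<chi> m. \<Sum>i<k n m. real i / real n powr (3 / 2) * \<eta> i x)" for n x
  \<comment> \<open>For small \<open>n\<close> the coefficient \<alpha> may vanish, and division by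
    it then returns 0, so the splitting into main term and remainder is claimed only for
    \<open>good n\<close>. Elsewhere \<open>r\<close> is set to 0, which keeps it square integrable
    for every \<open>n\<close>.\<close>
  define good where "good n \<longleftrightarrow> 0 < n \<and> 0 < \<alpha> n" for n
  define r where "r n m x = (if good n then 1 / (real n powr (3 / 2) * \<alpha> n) * (1 / sqrt s2) *
      (c + \<alpha> n * (\<Sum>i<k n m. garch_dev (\<alpha> n) c (\<lambda>i. \<xi> i x) i * \<xi> i x)) else 0)" for n m x
  define R where "R n x = (\<chi> m. r n m x)" for n x
  define Z where "Z n x = (\<chi> m. 1 / (real n powr (3 / 2) * \<alpha> n) * (1 / sqrt s2) *
      ((garch_sigma \<omega> (\<alpha> n) (\<beta> n) \<sigma>0 (\<lambda>k. \<epsilon> k x) (k n m))\<^sup>2 / \<omega> - real_of_int \<lfloor>real n * t m\<rfloor>))" for n x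
  have ev_good: "\<forall>\<^sub>F n in sequentially. good n"
  proof -
    have "\<forall>\<^sub>F n in sequentially. 0 < real n * \<alpha> n"
      using assms(16) by (simp add: filterlim_at_top_dense)
    then show ?thesis
      using eventually_gt_at_top[of 0] by eventually_elim (auto simp: good_def zero_less_mult_iff)
  qed

  have decomp: "Z n x = Q n x + R n x" if "good n" for n x
  proof (simp only: vec_eq_iff vector_add_component Z_def Q_def R_def vec_lambda_beta, rule allI)
    fix m
    have n: "0 < n" and a: "0 < \<alpha> n" using that by (auto simp: good_def)
    have b: "0 \<le> \<beta> n" "\<alpha> n + \<beta> n = 1" using assms(7,10)[of n] n by auto
    have floor: "real_of_int \<lfloor>real n * t m\<rfloor> = real (k n m)"
      using t_nonneg[of m] by (simp add: k_def)
    have "(garch_sigma \<omega> (\<alpha> n) (\<beta> n) \<sigma>0 (\<lambda>k. \<epsilon> k x) (k n m))\<^sup>2 / \<omega> - real (k n m) = garch_dev (\<alpha> n) c (\<lambda>i. \<xi> i x) (k n m)"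
      using garch_sigma_eq_dev[OF assms(5) less_imp_le[OF a] b] by (simp add: c_def \<xi>_def)
    also have "\<dots> = \<alpha> n * (\<Sum>i<k n m. real i * \<xi> i x) +
        (c + \<alpha> n * (\<Sum>i<k n m. garch_dev (\<alpha> n) c (\<lambda>i. \<xi> i x) i * \<xi> i x))"
      by (subst garch_dev_decomp) simp
    finally have dev: "(garch_sigma \<omega> (\<alpha> n) (\<beta> n) \<sigma>0 (\<lambda>k. \<epsilon> k x) (k n m))\<^sup>2 / \<omega> - real_of_int \<lfloor>real n * t m\<rfloor> =
        \<alpha> n * (\<Sum>i<k n m. real i * \<xi> i x) +
        (c + \<alpha> n * (\<Sum>i<k n m. garch_dev (\<alpha> n) c (\<lambda>i. \<xi> i x) i * \<xi> i x))"
      unfolding floor .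
    \<comment> \<open>The factor \<alpha> cancels, so the main term is a sum whose weights do not
      involve \<alpha>, as the central limit theorem for blocks expects.\<close>
    have main: "1 / (real n powr (3 / 2) * \<alpha> n) * (1 / sqrt s2) * (\<alpha> n * (\<Sum>i<k n m. real i * \<xi> i x)) =
        (\<Sum>i<k n m. real i / real n powr (3 / 2) * \<eta> i x)"
      using a n by (simp add: \<eta>_def sum_distrib_left)
    show "1 / (real n powr (3 / 2) * \<alpha> n) * (1 / sqrt s2) *
        ((garch_sigma \<omega> (\<alpha> n) (\<beta> n) \<sigma>0 (\<lambda>k. \<epsilon> k x) (k n m))\<^sup>2 / \<omega> - real_of_int \<lfloor>real n * t m\<rfloor>) =
        (\<Sum>i<k n m. real i / real n powr (3 / 2) * \<eta> i x) + r n m x"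
      unfolding dev distrib_left main[symmetric] using that by (simp add: r_def distrib_left)
  qed

  have Q_meas: "Q n \<in> borel_measurable M" for n
    by (rule borel_measurable_vec) (simp add: Q_def)
  have [measurable]: "(\<lambda>x. garch_dev a c (\<lambda>i. \<xi> i x) i) \<in> borel_measurable M" for a i
    by (rule past_process_measurable[OF past_garch_dev])
  have R_meas: "R n \<in> borel_measurable M" for n
    by (rule borel_measurable_vec) (simp add: R_def r_def)
  \<comment> \<open>The bound 1 arises from at most \<open>n\<close> terms of size at most 1/n each;
    for n = 0 the sum is empty.\<close>
  have Q_comp: "integrable M (\<lambda>x. (Q n x $ m)\<^sup>2)" "(\<integral>x. (Q n x $ m)\<^sup>2 \<partial>M) \<le> 1" for n m
  proof -
    define w where "w i = real i / real n powr (3 / 2) / sqrt s2" for i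
    have Q_eq: "Q n x $ m = (\<Sum>i<k n m. w i * \<xi> i x)" for x
      by (simp add: Q_def w_def \<eta>_def)
    show "integrable M (\<lambda>x. (Q n x $ m)\<^sup>2)"
      using weighted_sum_L2[of w "k n m"] by (simp add: Q_eq)
    have "(\<integral>x. (Q n x $ m)\<^sup>2 \<partial>M) = s2 * (\<Sum>i<k n m. (w i)\<^sup>2)"
      using weighted_sum_L2[of w "k n m"] by (simp add: Q_eq)
    also have "\<dots> = (\<Sum>i<k n m. (real i)\<^sup>2 / real n ^ 3)"
      using s2_pos by (simp add: w_def power_divide power_mult_distrib powr_three_halves_square sum_distrib_left)
    also have "\<dots> \<le> (\<Sum>i<k n m. 1 / real n)"
    proof (rule sum_mono)
      fix i assume "i \<in> {..<k n m}"
      then have i: "i < n" using k_le[of n m] by simp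
      then have "(real i)\<^sup>2 \<le> (real n)\<^sup>2" by (intro power_mono) auto
      then have "(real i)\<^sup>2 / real n ^ 3 \<le> (real n)\<^sup>2 / real n ^ 3" by (intro divide_right_mono) auto
      also have "\<dots> = 1 / real n" using i by (simp add: power2_eq_square power3_eq_cube)
      finally show "(real i)\<^sup>2 / real n ^ 3 \<le> 1 / real n" .
    qed
    also have "\<dots> \<le> 1" using k_le[of n m] by (cases "n = 0") (auto simp: field_simps)
    finally show "(\<integral>x. (Q n x $ m)\<^sup>2 \<partial>M) \<le> 1" .
  qed
  define \<rho> where "\<rho> n = 2 * c\<^sup>2 / s2 * (1 / real n) * (1 / (real n * \<alpha> n))\<^sup>2 +
      2 * exp (real n * (2 * (\<alpha> n)\<^sup>2 * s2)) * (c\<^sup>2 * (1 / real n)\<^sup>2 + real n * (2 * (\<alpha> n)\<^sup>2 * s2))" for n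
  have r_sq: "integrable M (\<lambda>x. (r n m x)\<^sup>2)" for n m
    using normalized_remainder_L2(1)[OF s2_pos _ _ k_le] by (cases "good n") (auto simp: r_def good_def)
  have r_le: "(\<integral>x. (r n m x)\<^sup>2 \<partial>M) \<le> \<rho> n" if "good n" for n m
    using normalized_remainder_L2(2)[OF s2_pos _ _ k_le, of "\<alpha> n" n c m] that by (auto simp: r_def \<rho>_def good_def)
  have \<rho>_lim: "\<rho> \<longlonglongrightarrow> 0"
  proof -
    have inv: "(\<lambda>n. 1 / (real n * \<alpha> n)) \<longlonglongrightarrow> 0"
      using tendsto_inverse_0_at_top[OF assms(16)] by (simp add: inverse_eq_divide)
    \<comment> \<open>The exponent in \<rho> is twice \<open>s2\<close> times the square of n^(1/2)
      \<alpha>.\<close>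
    have "(\<lambda>n. 2 * s2 * (sqrt (real n) * \<alpha> n)\<^sup>2) \<longlonglongrightarrow> 2 * s2 * 0\<^sup>2"
      by (intro tendsto_intros assms(15))
    then have u: "(\<lambda>n. real n * (2 * (\<alpha> n)\<^sup>2 * s2)) \<longlonglongrightarrow> 0"
      by (simp add: power_mult_distrib mult_ac)
    have "\<rho> \<longlonglongrightarrow> 2 * c\<^sup>2 / s2 * 0 * 0\<^sup>2 + 2 * exp 0 * (c\<^sup>2 * 0\<^sup>2 + 0)"
      unfolding \<rho>_def by (intro tendsto_intros inv u lim_1_over_n)
    then show ?thesis by simp
  qed
  have R_lim: "(\<lambda>n. \<integral>x. (norm (R n x))\<^sup>2 \<partial>M) \<longlonglongrightarrow> 0"
  proof (rule tendsto_sandwich[where f="\<lambda>_. 0" and h="\<lambda>n. real CARD('n) * \<rho> n"])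
    show "\<forall>\<^sub>F n in sequentially. (\<integral>x. (norm (R n x))\<^sup>2 \<partial>M) \<le> real CARD('n) * \<rho> n"
      using ev_good
    proof eventually_elim
      case (elim n)
      have "(\<integral>x. (norm (R n x))\<^sup>2 \<partial>M) = (\<Sum>m\<in>UNIV. \<integral>x. (r n m x)\<^sup>2 \<partial>M)"
        using r_sq by (simp add: norm_vec_sq R_def)
      also have "\<dots> \<le> (\<Sum>m\<in>(UNIV :: 'n set). \<rho> n)" by (intro sum_mono r_le elim)
      finally show ?case by simp
    qed
    show "(\<lambda>n. real CARD('n) * \<rho> n) \<longlonglongrightarrow> 0" using \<rho>_lim by (rule tendsto_mult_right_zero)
  qed auto

  have "weakly_converges (\<lambda>n. distr M borel (Z n)) (partial_sums_law v)"
    unfolding weakly_converges_def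
  proof (intro allI impI)
    fix f :: "real ^ 'n::{finite, linorder} \<Rightarrow> real"
    assume cont: "continuous_on UNIV f" and bdd: "bounded (range f)"
    have f: "f \<in> borel_measurable borel" using cont by (rule borel_measurable_continuous_onI)
    have "(\<lambda>n. (\<integral>x. f (Q n x + R n x) \<partial>M) - (\<integral>x. f (Q n x) \<partial>M)) \<longlonglongrightarrow> 0"
    proof (rule expectation_perturbation_tendsto[OF Q_meas R_meas _ _ _ R_lim cont bdd])
      show "integrable M (\<lambda>x. (norm (Q n x))\<^sup>2)" for n
        using Q_comp(1) by (simp add: norm_vec_sq)
      show "(\<integral>x. (norm (Q n x))\<^sup>2 \<partial>M) \<le> real CARD('n)" for n
      proof -
        have "(\<integral>x. (norm (Q n x))\<^sup>2 \<partial>M) = (\<Sum>m\<in>UNIV. \<integral>x. (Q n x $ m)\<^sup>2 \<partial>M)"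
          using Q_comp(1) by (simp add: norm_vec_sq)
        also have "\<dots> \<le> (\<Sum>m\<in>(UNIV :: 'n set). 1)" by (intro sum_mono Q_comp(2))
        finally show ?thesis by simp
      qed
      show "integrable M (\<lambda>x. (norm (R n x))\<^sup>2)" for n
        using r_sq by (simp add: norm_vec_sq R_def)
    qed
    from tendsto_add[OF this v_lim[OF cont bdd]]
    have "(\<lambda>n. \<integral>x. f (Q n x + R n x) \<partial>M) \<longlonglongrightarrow> (\<integral>z. f z \<partial>partial_sums_law v)"
      by (simp add: Q_def k_def)
    \<comment> \<open>Equality holds only where \<open>good n\<close> does; finitely many exceptions
      do not affect the limit.\<close>
    moreover have "\<forall>\<^sub>F n in sequentially. (\<integral>x. f (Q n x + R n x) \<partial>M) = (\<integral>z. f z \<partial>distr M borel (Z n))"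
      using ev_good
    proof eventually_elim
      case (elim n)
      have Z_eq: "Z n = (\<lambda>x. Q n x + R n x)" using decomp[OF elim] by auto
      have "Z n \<in> borel_measurable M"
        unfolding Z_eq using Q_meas R_meas by (rule borel_measurable_add)
      then have "(\<integral>z. f z \<partial>distr M borel (Z n)) = (\<integral>x. f (Z n x) \<partial>M)"
        using f by (rule integral_distr)
      then show ?case by (simp add: Z_eq)
    qed
    ultimately show "(\<lambda>n. \<integral>z. f z \<partial>distr M borel (Z n)) \<longlonglongrightarrow> (\<integral>z. f z \<partial>partial_sums_law v)"
      by (rule Lim_transform_eventually)
  qed
  \<comment> \<open>The increments up to \<open>min i j\<close> have total variance t^3 / 3 at that
    index, and a monotone \<open>t\<close> commutes with the minimum.\<close>
  moreover have "(\<integral>z. z $ i * z $ j \<partial>partial_sums_law v) = 1 / 3 * (min (t i) (t j)) ^ 3" for i j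
    using partial_sums_law_moments(2)[of v, OF v] v_sum[of "min i j"] min_of_mono[OF mono_t, of i j] by simp
  moreover have "Z = (\<lambda>n x. \<chi> m.
                1 / (real n powr (3 / 2) * \<alpha> n) *
                (1 / sqrt (\<integral>u. ((\<epsilon> 0 u)\<^sup>2 - 1)\<^sup>2 \<partial>M)) *
                ((garch_sigma \<omega> (\<alpha> n) (\<beta> n) \<sigma>0 (\<lambda>k. \<epsilon> k x) (nat \<lfloor>real n * t m\<rfloor>))\<^sup>2 / \<omega>
                   - real_of_int \<lfloor>real n * t m\<rfloor>))"
    by (simp add: Z_def k_def s2_def \<xi>_def fun_eq_iff)
  ultimately show ?thesis
    using multivariate_gaussian_partial_sums_law[of v, OF v] partial_sums_law_moments(1)[of v, OF v] by auto
qed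

end
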